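(* Let $F:X\to Y$ be a shape morphism of topological spaces with $\operatorname{sd}F\le n$, where $n\ge 0$ is an integer. Then for any Abelian group $G$ and for every index $k>n$ the Čech homology homomorphism $\check F_k:\check H_k(X;G)\to\check H_k(Y;G)$ induced by $F$ is null (the zero homomorphism).
   Context: HTop is the homotopy category of topological spaces: objects are all topological spaces, morphisms are homotopy classes $[f]$ of continuous maps, called H-maps. A polyhedron is the carrier $P=|K|$ (weak topology) of a simplicial complex $K$, and $\dim P\le n$ means every simplex of $K$ has dimension $\le n$. HPol is the full subcategory of HTop whose objects are the spaces having the homotopy type of a polyhedron. An inverse system $\mathbf X=(X_\lambda,p_{\lambda\lambda'},\Lambda)$ in a category consists of a directed set $\Lambda$, objects $X_\lambda$, and morphisms $p_{\lambda\lambda'}:X_{\lambda'}\to X_\lambda$ for $\lambda\le\lambda'$ with $p_{\lambda\lambda}=1$, $p_{\lambda\lambda'}p_{\lambda'\lambda''}=p_{\lambda\lambda''}$. A morphism of inverse systems $(f_\mu,\phi):\mathbf X\to\mathbf Y=(Y_\mu,q_{\mu\mu'},M)$ is a function $\phi:M\to\Lambda$ with morphisms $f_\mu:X_{\phi(\mu)}\to Y_\mu$ such that for all $\mu\le\mu'$ there is $\lambda\ge\phi(\mu),\phi(\mu')$ with $f_\mu p_{\phi(\mu)\lambda}=q_{\mu\mu'}f_{\mu'}p_{\phi(\mu')\lambda}$. Write $f_{\mu\lambda}:=f_\mu\circ p_{\phi(\mu)\lambda}$ for $\lambda\ge\phi(\mu)$. Two such morphisms are equivalent, $(f_\mu,\phi)\sim(f'_\mu,\phi')$,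 if for every $\mu$ there is $\lambda\ge\phi(\mu),\phi'(\mu)$ with $f_{\mu\lambda}=f'_{\mu\lambda}$. The pro-category has inverse systems as objects and equivalence classes $\mathbf f=[(f_\mu,\phi)]$ as morphisms (pro-morphisms). An HPol-expansion of a space $X$ is an inverse system $\mathbf X$ in HPol with a morphism $\mathbf p=(p_\lambda):X\to\mathbf X$ of pro-HTop such that for every $P\in$ HPol: (E1) each H-map $h:X\to P$ is $h=h'p_\lambda$ for some $\lambda$ and some H-map $h':X_\lambda\to P$; (E2) if $h',h'':X_\lambda\to P$ satisfy $h'p_\lambda=h''p_\lambda$, then $h'p_{\lambda\lambda'}=h''p_{\lambda\lambda'}$ for some $\lambda'\ge\lambda$. A shape morphism $F:X\to Y$ is represented by a pro-morphism $\mathbf f:\mathbf X\to\mathbf Y$ in pro-HPol between HPol-expansions $\mathbf p:X\to\mathbf X$, $\mathbf q:Y\to\mathbf Y$; $\mathbf f:\mathbf X\to\mathbf Y$ and $\mathbf f':\mathbf X'\to\mathbf Y'$ represent the same $F$ iff $\mathbf j\mathbf f=\mathbf f'\mathbf i$, where $\mathbf i:\mathbf X\to\mathbf X'$, $\mathbf j:\mathbf Y\to\mathbf Y'$ are the unique isomorphisms with $\mathbf i\mathbf p=\mathbf p'$, $\mathbf j\mathbf q=\mathbf q'$. A morphism of inverse systems $(f_\mu,\phi)$ in HPol has $\dim(f_\mu,\phi)\le n$ if every $\mu\in M$ admits $\lambda\ge\phi(\mu)$ such that $f_{\mu\lambda}=v\circ u$ for some H-maps $u:X_\lambda\to P$,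 $v:P\to Y_\mu$ with $P$ a polyhedron, $\dim P\le n$. A pro-morphism $\mathbf f$ has $\dim\mathbf f\le n$ if it has a representative $(f_\mu,\phi)$ with $\dim(f_\mu,\phi)\le n$. A shape morphism $F$ has $\operatorname{sd}F\le n$ if it has a representation $\mathbf f:\mathbf X\to\mathbf Y$ with $\dim\mathbf f\le n$. Čech homology: $\check H_k(X;G)=\varprojlim_\lambda H_k(X_\lambda;G)$ for an HPol-expansion $X\to\mathbf X=(X_\lambda,p_{\lambda\lambda'},\Lambda)$ (singular homology; independent of the expansion up to canonical isomorphism), and $\check F_k$ is the inverse limit of the morphism of pro-groups represented by $(H_k(f_\mu;G),\phi)$, where $(f_\mu,\phi)$ represents $F$. *)

theory Defs
  imports "HOL-Homology.Homology"
begin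

section \<open>The homotopy category\<close>

text \<open>
  HOL has no universe of all topological spaces, so an arbitrary type \<open>'a\<close> takes its place:
  spaces are values of type \<open>'a topology\<close>, and results hold for every \<open>'a\<close>. Auxiliary spaces may
  have other point types, so morphism sets and composition are polymorphic.
\<close>

definition homotopy_rel :: "'a topology \<Rightarrow> 'b topology \<Rightarrow> (('a \<Rightarrow> 'b) \<times> ('a \<Rightarrow> 'b)) set"
  where "homotopy_rel X Y = {(f, g). homotopic_with (\<lambda>_. True) X Y f g}"

definition hclass :: "'a topology \<Rightarrow> 'b topology \<Rightarrow> ('a \<Rightarrow> 'b) \<Rightarrow> ('a \<Rightarrow> 'b) set"
  where "hclass X Y f = homotopy_rel X Y `` {f}"

definition hmaps :: "'a topology \<Rightarrow> 'b topology \<Rightarrow> ('a \<Rightarrow> 'b) set set"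
  where "hmaps X Y = {f. continuous_map X Y f} // homotopy_rel X Y"

definition hid :: "'a topology \<Rightarrow> ('a \<Rightarrow> 'a) set"
  where "hid X = hclass X X id"

definition hcomp ::
    "'a topology \<Rightarrow> 'c topology \<Rightarrow> ('b \<Rightarrow> 'c) set \<Rightarrow> ('a \<Rightarrow> 'b) set \<Rightarrow> ('a \<Rightarrow> 'c) set"
  where "hcomp X Z b a = (\<Union>g\<in>b. \<Union>f\<in>a. hclass X Z (g \<circ> f))"

lemma equiv_homotopy_rel: "equiv {f. continuous_map X Y f} (homotopy_rel X Y)"
proof (rule equivI)
  show "homotopy_rel X Y \<subseteq> {f. continuous_map X Y f} \<times> {f. continuous_map X Y f}"
    by (auto simp: homotopy_rel_def dest: homotopic_with_imp_continuous_maps)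
  show "refl_on {f. continuous_map X Y f} (homotopy_rel X Y)"
    by (simp add: homotopy_rel_def refl_on_def)
  show "sym (homotopy_rel X Y)"
    by (rule symI) (simp add: homotopy_rel_def homotopic_with_symD)
  show "trans (homotopy_rel X Y)"
    by (rule transI) (simp add: homotopy_rel_def, rule homotopic_with_trans)
qed

lemma hcomp_hclass:
  assumes f: "continuous_map X Y f" and g: "continuous_map Y Z g"
  shows "hcomp X Z (hclass Y Z g) (hclass X Y f) = hclass X Z (g \<circ> f)"
proof -
  have eq: "hclass X Z (g' \<circ> f') = hclass X Z (g \<circ> f)"
    if "g' \<in> hclass Y Z g" "f' \<in> hclass X Y f" for g' f'
  proof -
    have "homotopic_with (\<lambda>_. True) X Z (g \<circ> f) (g' \<circ> f')"
      using that by (intro homotopic_compose[of X Y f f' Z g g']) (auto simp: hclass_def homotopy_rel_def)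
    then have "(g \<circ> f, g' \<circ> f') \<in> homotopy_rel X Z"
      by (simp add: homotopy_rel_def)
    then show ?thesis
      unfolding hclass_def by (rule equiv_class_eq[OF equiv_homotopy_rel, symmetric])
  qed
  have mem: "g \<in> hclass Y Z g" "f \<in> hclass X Y f"
    using f g by (simp_all add: hclass_def homotopy_rel_def)
  show ?thesis
    unfolding hcomp_def
  proof (rule subset_antisym)
    show "(\<Union>g'\<in>hclass Y Z g. \<Union>f'\<in>hclass X Y f. hclass X Z (g' \<circ> f')) \<subseteq> hclass X Z (g \<circ> f)"
      by (intro UN_least) (simp add: eq)
    show "hclass X Z (g \<circ> f) \<subseteq> (\<Union>g'\<in>hclass Y Z g. \<Union>f'\<in>hclass X Y f. hclass X Z (g' \<circ> f'))"
      by (rule SUP_upper2[OF mem(1)], rule SUP_upper2[OF mem(2)], rule subset_refl)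
  qed
qed


section \<open>Polyhedra\<close>

definition abstract_complex :: "'v set set \<Rightarrow> bool"
  where "abstract_complex K \<longleftrightarrow>
    (\<forall>\<sigma>\<in>K. finite \<sigma> \<and> \<sigma> \<noteq> {} \<and> (\<forall>\<tau>. \<tau> \<subseteq> \<sigma> \<longrightarrow> \<tau> \<noteq> {} \<longrightarrow> \<tau> \<in> K))"

definition complex_dim_le :: "'v set set \<Rightarrow> nat \<Rightarrow> bool"
  where "complex_dim_le K n \<longleftrightarrow> (\<forall>\<sigma>\<in>K. card \<sigma> \<le> Suc n)"

text \<open>Points of the carrier are given by barycentric coordinates.\<close>

definition closed_simplex :: "'v set \<Rightarrow> ('v \<Rightarrow> real) set"
  where "closed_simplex \<sigma> =
    {\<alpha>. (\<forall>v. 0 \<le> \<alpha> v) \<and> (\<forall>v. v \<notin> \<sigma> \<longrightarrow> \<alpha> v = 0) \<and> (\<Sum>v\<in>\<sigma>. \<alpha> v) = 1}"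

text \<open>
  The weak topology. For finite \<open>\<sigma>\<close> the product topology of \<open>'v \<Rightarrow> real\<close> induces the
  Euclidean topology on \<open>closed_simplex \<sigma>\<close>.
\<close>

definition polyhedron :: "'v set set \<Rightarrow> ('v \<Rightarrow> real) topology"
  where "polyhedron K = topology (\<lambda>U. U \<subseteq> (\<Union>\<sigma>\<in>K. closed_simplex \<sigma>) \<and>
    (\<forall>\<sigma>\<in>K. openin (subtopology (powertop_real UNIV) (closed_simplex \<sigma>)) (U \<inter> closed_simplex \<sigma>)))"

lemma openin_polyhedron:
  "openin (polyhedron K) U \<longleftrightarrow> U \<subseteq> (\<Union>\<sigma>\<in>K. closed_simplex \<sigma>) \<and>
    (\<forall>\<sigma>\<in>K. openin (subtopology (powertop_real UNIV) (closed_simplex \<sigma>)) (U \<inter> closed_simplex \<sigma>))"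
proof -
  let ?T = "\<lambda>\<sigma>. subtopology (powertop_real UNIV) (closed_simplex \<sigma>)"
  have "istopology (\<lambda>U. U \<subseteq> (\<Union>\<sigma>\<in>K. closed_simplex \<sigma>) \<and>
      (\<forall>\<sigma>\<in>K. openin (?T \<sigma>) (U \<inter> closed_simplex \<sigma>)))"
    unfolding istopology_def
  proof (intro conjI allI impI ballI)
    fix S T \<sigma>
    assume S: "S \<subseteq> (\<Union>\<sigma>\<in>K. closed_simplex \<sigma>) \<and> (\<forall>\<sigma>\<in>K. openin (?T \<sigma>) (S \<inter> closed_simplex \<sigma>))"
      and T: "T \<subseteq> (\<Union>\<sigma>\<in>K. closed_simplex \<sigma>) \<and> (\<forall>\<sigma>\<in>K. openin (?T \<sigma>) (T \<inter> closed_simplex \<sigma>))"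
      and \<sigma>: "\<sigma> \<in> K"
    have "S \<inter> T \<inter> closed_simplex \<sigma> = (S \<inter> closed_simplex \<sigma>) \<inter> (T \<inter> closed_simplex \<sigma>)"
      by blast
    then show "openin (?T \<sigma>) (S \<inter> T \<inter> closed_simplex \<sigma>)"
      using S T \<sigma> by auto
  next
    fix \<K> \<sigma>
    assume \<K>: "\<forall>U\<in>\<K>. U \<subseteq> (\<Union>\<sigma>\<in>K. closed_simplex \<sigma>) \<and>
        (\<forall>\<sigma>\<in>K. openin (?T \<sigma>) (U \<inter> closed_simplex \<sigma>))" and \<sigma>: "\<sigma> \<in> K"
    have "openin (?T \<sigma>) (\<Union>U\<in>\<K>. U \<inter> closed_simplex \<sigma>)"
    proof (rule openin_Union)
      show "openin (?T \<sigma>) U" if "U \<in> (\<lambda>U. U \<inter> closed_simplex \<sigma>) ` \<K>" for U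
        using that \<K> \<sigma> by fastforce
    qed
    then show "openin (?T \<sigma>) (\<Union>\<K> \<inter> closed_simplex \<sigma>)"
      by (simp only: Int_Union2)
  next
    fix S T
    assume "S \<subseteq> (\<Union>\<sigma>\<in>K. closed_simplex \<sigma>) \<and> (\<forall>\<sigma>\<in>K. openin (?T \<sigma>) (S \<inter> closed_simplex \<sigma>))"
    then show "S \<inter> T \<subseteq> (\<Union>\<sigma>\<in>K. closed_simplex \<sigma>)"
      by (meson inf.coboundedI1)
  next
    fix \<K>
    assume "\<forall>U\<in>\<K>. U \<subseteq> (\<Union>\<sigma>\<in>K. closed_simplex \<sigma>) \<and>
        (\<forall>\<sigma>\<in>K. openin (?T \<sigma>) (U \<inter> closed_simplex \<sigma>))"
    then show "\<Union>\<K> \<subseteq> (\<Union>\<sigma>\<in>K. closed_simplex \<sigma>)"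
      by (meson Union_least)
  qed
  then show ?thesis
    by (simp add: polyhedron_def)
qed

text \<open>
  Taking the vertices in the point type of the space loses nothing: if a space with points in
  \<open>'a\<close> has the homotopy type of some polyhedron at all, it has that of a polyhedron with vertices
  in \<open>'a\<close>.
\<close>

definition hpol :: "'a topology \<Rightarrow> bool"
  where "hpol X \<longleftrightarrow>
    (\<exists>K :: 'a set set. abstract_complex K \<and> X homotopy_equivalent_space polyhedron K)"


section \<open>Inverse systems and pro-morphisms\<close>

text \<open>
  \<open>bond S \<lambda> \<lambda>'\<close> is the morphism from \<open>obj S \<lambda>'\<close> to \<open>obj S \<lambda>\<close>. The record is shared by systems
  of spaces (with H-maps) and systems of groups (with homomorphisms).
\<close>

record ('i, 'o, 'm) inv_sys =
  idx :: "'i set"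
  ile :: "'i \<Rightarrow> 'i \<Rightarrow> bool"
  obj :: "'i \<Rightarrow> 'o"
  bond :: "'i \<Rightarrow> 'i \<Rightarrow> 'm"

type_synonym ('i, 'a) top_sys = "('i, 'a topology, ('a \<Rightarrow> 'a) set) inv_sys"

definition directed :: "'i set \<Rightarrow> ('i \<Rightarrow> 'i \<Rightarrow> bool) \<Rightarrow> bool"
  where "directed I r \<longleftrightarrow> I \<noteq> {} \<and> (\<forall>i\<in>I. r i i) \<and>
    (\<forall>i\<in>I. \<forall>j\<in>I. \<forall>k\<in>I. r i j \<longrightarrow> r j k \<longrightarrow> r i k) \<and>
    (\<forall>i\<in>I. \<forall>j\<in>I. \<exists>k\<in>I. r i k \<and> r j k)"

definition htop_system :: "('i, 'a) top_sys \<Rightarrow> bool"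
  where "htop_system S \<longleftrightarrow> directed (idx S) (ile S) \<and>
    (\<forall>i\<in>idx S. \<forall>j\<in>idx S. ile S i j \<longrightarrow> bond S i j \<in> hmaps (obj S j) (obj S i)) \<and>
    (\<forall>i\<in>idx S. bond S i i = hid (obj S i)) \<and>
    (\<forall>i\<in>idx S. \<forall>j\<in>idx S. \<forall>k\<in>idx S. ile S i j \<longrightarrow> ile S j k \<longrightarrow>
      hcomp (obj S k) (obj S i) (bond S i j) (bond S j k) = bond S i k)"

definition hpol_system :: "('i, 'a) top_sys \<Rightarrow> bool"
  where "hpol_system S \<longleftrightarrow> htop_system S \<and> (\<forall>i\<in>idx S. hpol (obj S i))"

text \<open>A morphism of inverse systems from \<open>S\<close> to \<open>T\<close> is a pair of a family and an index function.\<close>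

type_synonym ('i, 'j, 'a) sys_mor = "('j \<Rightarrow> ('a \<Rightarrow> 'a) set) \<times> ('j \<Rightarrow> 'i)"

definition along ::
    "('i, 'a) top_sys \<Rightarrow> ('j, 'a) top_sys \<Rightarrow> ('i, 'j, 'a) sys_mor \<Rightarrow> 'j \<Rightarrow> 'i \<Rightarrow> ('a \<Rightarrow> 'a) set"
  where "along S T h \<mu> l =
    hcomp (obj S l) (obj T \<mu>) (fst h \<mu>) (bond S (snd h \<mu>) l)"

definition sys_mors :: "('i, 'a) top_sys \<Rightarrow> ('j, 'a) top_sys \<Rightarrow> ('i, 'j, 'a) sys_mor set"
  where "sys_mors S T = {(f, \<phi>). \<phi> \<in> idx T \<rightarrow> idx S \<and>
    (\<forall>\<mu>\<in>idx T. f \<mu> \<in> hmaps (obj S (\<phi> \<mu>)) (obj T \<mu>)) \<and>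
    (\<forall>\<mu>\<in>idx T. \<forall>\<mu>'\<in>idx T. ile T \<mu> \<mu>' \<longrightarrow>
      (\<exists>l\<in>idx S. ile S (\<phi> \<mu>) l \<and> ile S (\<phi> \<mu>') l \<and>
        along S T (f, \<phi>) \<mu> l =
          hcomp (obj S l) (obj T \<mu>) (bond T \<mu> \<mu>') (along S T (f, \<phi>) \<mu>' l)))}"

definition sys_mor_rel ::
    "('i, 'a) top_sys \<Rightarrow> ('j, 'a) top_sys \<Rightarrow> (('i, 'j, 'a) sys_mor \<times> ('i, 'j, 'a) sys_mor) set"
  where "sys_mor_rel S T = {(h, h'). h \<in> sys_mors S T \<and> h' \<in> sys_mors S T \<and>
    (\<forall>\<mu>\<in>idx T. \<exists>l\<in>idx S. ile S (snd h \<mu>) l \<and> ile S (snd h' \<mu>) l \<and>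
      along S T h \<mu> l = along S T h' \<mu> l)}"

definition pro_class ::
    "('i, 'a) top_sys \<Rightarrow> ('j, 'a) top_sys \<Rightarrow> ('i, 'j, 'a) sys_mor \<Rightarrow> ('i, 'j, 'a) sys_mor set"
  where "pro_class S T h = sys_mor_rel S T `` {h}"

definition pro_mors :: "('i, 'a) top_sys \<Rightarrow> ('j, 'a) top_sys \<Rightarrow> ('i, 'j, 'a) sys_mor set set"
  where "pro_mors S T = sys_mors S T // sys_mor_rel S T"

definition sys_comp ::
    "('i, 'a) top_sys \<Rightarrow> ('k, 'a) top_sys \<Rightarrow> ('j, 'k, 'a) sys_mor \<Rightarrow> ('i, 'j, 'a) sys_mor
      \<Rightarrow> ('i, 'k, 'a) sys_mor"
  where "sys_comp S U = (\<lambda>(g, \<psi>) (f, \<phi>).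
    (\<lambda>\<nu>. hcomp (obj S (\<phi> (\<psi> \<nu>))) (obj U \<nu>) (g \<nu>) (f (\<psi> \<nu>)), \<phi> \<circ> \<psi>))"

definition pro_comp ::
    "('i, 'a) top_sys \<Rightarrow> ('k, 'a) top_sys \<Rightarrow> ('j, 'k, 'a) sys_mor set \<Rightarrow> ('i, 'j, 'a) sys_mor set
      \<Rightarrow> ('i, 'k, 'a) sys_mor set"
  where "pro_comp S U \<g> \<f> = (\<Union>g\<in>\<g>. \<Union>f\<in>\<f>. pro_class S U (sys_comp S U g f))"

definition pro_id :: "('i, 'a) top_sys \<Rightarrow> ('i, 'i, 'a) sys_mor set"
  where "pro_id S = pro_class S S (\<lambda>i. hid (obj S i), id)"

definition pro_isos :: "('i, 'a) top_sys \<Rightarrow> ('j, 'a) top_sys \<Rightarrow> ('i, 'j, 'a) sys_mor set set"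
  where "pro_isos S T = {\<f> \<in> pro_mors S T. \<exists>\<g>\<in>pro_mors T S.
    pro_comp S S \<g> \<f> = pro_id S \<and> pro_comp T T \<f> \<g> = pro_id T}"


section \<open>Expansions and shape morphisms\<close>

text \<open>A space as an inverse system over a one-point index set.\<close>

definition rudimentary :: "'a topology \<Rightarrow> (unit, 'a) top_sys"
  where "rudimentary X =
    \<lparr>idx = UNIV, ile = (\<lambda>_ _. True), obj = (\<lambda>_. X), bond = (\<lambda>_ _. hid X)\<rparr>"

definition cone_mor :: "('i \<Rightarrow> ('a \<Rightarrow> 'a) set) \<Rightarrow> (unit, 'i, 'a) sys_mor"
  where "cone_mor p = (p, \<lambda>_. ())"

text \<open>
  The test spaces \<open>P\<close> of (E1) and (E2) have points in \<open>'a \<Rightarrow> real\<close>. This amounts to testing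
  against all of HPol: a map (or homotopy of maps) from a space with points in \<open>'a\<close> into a
  polyhedron lies in a subcomplex that is homeomorphic to one realised in \<open>'a \<Rightarrow> real\<close>, whereas
  the type \<open>'a\<close> itself might be too small to contain such a copy.
\<close>

definition hpol_expansion ::
    "'a topology \<Rightarrow> ('i, 'a) top_sys \<Rightarrow> ('i \<Rightarrow> ('a \<Rightarrow> 'a) set) \<Rightarrow> bool"
  where "hpol_expansion X S p \<longleftrightarrow>
    hpol_system S \<and> cone_mor p \<in> sys_mors (rudimentary X) S \<and>
    (\<forall>P :: ('a \<Rightarrow> real) topology. hpol P \<longrightarrow>
      (\<forall>h\<in>hmaps X P. \<exists>l\<in>idx S. \<exists>h'\<in>hmaps (obj S l) P. h = hcomp X P h' (p l)) \<and>
      (\<forall>l\<in>idx S. \<forall>h'\<in>hmaps (obj S l) P. \<forall>h''\<in>hmaps (obj S l) P.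
        hcomp X P h' (p l) = hcomp X P h'' (p l) \<longrightarrow>
        (\<exists>l'\<in>idx S. ile S l l' \<and>
          hcomp (obj S l') P h' (bond S l l') = hcomp (obj S l') P h'' (bond S l l'))))"

text \<open>
  A representation \<open>(S, p, T, q, \<f>)\<close> consists of expansions \<open>p : X \<rightarrow> S\<close>, \<open>q : Y \<rightarrow> T\<close> and a
  pro-morphism \<open>\<f> : S \<rightarrow> T\<close>.
\<close>

type_synonym ('i, 'j, 'a) shape_rep =
  "('i, 'a) top_sys \<times> ('i \<Rightarrow> ('a \<Rightarrow> 'a) set) \<times> ('j, 'a) top_sys \<times> ('j \<Rightarrow> ('a \<Rightarrow> 'a) set)
    \<times> ('i, 'j, 'a) sys_mor set"

definition shape_reps :: "'a topology \<Rightarrow> 'a topology \<Rightarrow> ('i, 'j, 'a) shape_rep set"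
  where "shape_reps X Y = {(S, p, T, q, \<f>).
    hpol_expansion X S p \<and> hpol_expansion Y T q \<and> \<f> \<in> pro_mors S T}"

text \<open>The isomorphisms \<open>\<a>\<close> and \<open>\<b>\<close> exist and are unique, by the properties of expansions.\<close>

definition shape_rel ::
    "'a topology \<Rightarrow> 'a topology \<Rightarrow> (('i, 'j, 'a) shape_rep \<times> ('i, 'j, 'a) shape_rep) set"
  where "shape_rel X Y = {((S, p, T, q, \<f>), (S', p', T', q', \<f>')).
    (S, p, T, q, \<f>) \<in> shape_reps X Y \<and> (S', p', T', q', \<f>') \<in> shape_reps X Y \<and>
    (\<exists>\<a>\<in>pro_isos S S'. \<exists>\<b>\<in>pro_isos T T'.
      pro_comp (rudimentary X) S' \<a> (pro_class (rudimentary X) S (cone_mor p)) =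
        pro_class (rudimentary X) S' (cone_mor p') \<and>
      pro_comp (rudimentary Y) T' \<b> (pro_class (rudimentary Y) T (cone_mor q)) =
        pro_class (rudimentary Y) T' (cone_mor q') \<and>
      pro_comp S T' \<b> \<f> = pro_comp S T' \<f>' \<a>)}"

definition shape_mors :: "'a topology \<Rightarrow> 'a topology \<Rightarrow> ('i, 'j, 'a) shape_rep set set"
  where "shape_mors X Y = shape_reps X Y // shape_rel X Y"


section \<open>Shape dimension\<close>

text \<open>
  It suffices to consider complexes with vertices in \<open>'a\<close>: an H-map from a space with points in
  \<open>'a\<close> into any polyhedron factors through such a polyhedron of no larger dimension (a subcomplex
  containing the image if \<open>'a\<close> is infinite, a discrete set if \<open>'a\<close> is finite).
\<close>

definition sys_mor_dim_le ::
    "('i, 'a) top_sys \<Rightarrow> ('j, 'a) top_sys \<Rightarrow> ('i, 'j, 'a) sys_mor \<Rightarrow> nat \<Rightarrow> bool"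
  where "sys_mor_dim_le S T h n \<longleftrightarrow>
    (\<forall>\<mu>\<in>idx T. \<exists>l\<in>idx S. ile S (snd h \<mu>) l \<and>
      (\<exists>K :: 'a set set. abstract_complex K \<and> complex_dim_le K n \<and>
        (\<exists>u\<in>hmaps (obj S l) (polyhedron K). \<exists>v\<in>hmaps (polyhedron K) (obj T \<mu>).
          along S T h \<mu> l = hcomp (obj S l) (obj T \<mu>) v u)))"

definition pro_dim_le ::
    "('i, 'a) top_sys \<Rightarrow> ('j, 'a) top_sys \<Rightarrow> ('i, 'j, 'a) sys_mor set \<Rightarrow> nat \<Rightarrow> bool"
  where "pro_dim_le S T \<f> n \<longleftrightarrow> (\<exists>h\<in>\<f>. sys_mor_dim_le S T h n)"

definition sd_le :: "('i, 'j, 'a) shape_rep set \<Rightarrow> nat \<Rightarrow> bool"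
  where "sd_le F n \<longleftrightarrow> (\<exists>(S, p, T, q, \<f>)\<in>F. pro_dim_le S T \<f> n)"


section \<open>Singular homology with coefficients\<close>

text \<open>
  A chain is a finitely supported function from singular simplices to the coefficient group; for
  integer coefficients this is the library's singular homology. The arguments of type \<open>'g itself\<close>
  only fix the coefficient group.
\<close>

type_synonym ('a, 'g) gchain = "((nat \<Rightarrow> real) \<Rightarrow> 'a) \<Rightarrow>\<^sub>0 'g"

definition gchain_boundary :: "nat \<Rightarrow> ('a, 'g::ab_group_add) gchain \<Rightarrow> ('a, 'g) gchain"
  where "gchain_boundary k c = (if k = 0 then 0 else
    (\<Sum>s\<in>Poly_Mapping.keys c. \<Sum>i\<le>k. Poly_Mapping.single (singular_face k i s)
      (if even i then Poly_Mapping.lookup c s else - Poly_Mapping.lookup c s)))"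

definition gchain_map :: "nat \<Rightarrow> ('a \<Rightarrow> 'b) \<Rightarrow> ('a, 'g::ab_group_add) gchain \<Rightarrow> ('b, 'g) gchain"
  where "gchain_map k f c =
    (\<Sum>s\<in>Poly_Mapping.keys c. Poly_Mapping.single (simplex_map k f s) (Poly_Mapping.lookup c s))"

definition gchains :: "nat \<Rightarrow> 'a topology \<Rightarrow> ('a, 'g::ab_group_add) gchain set"
  where "gchains k X = {c. Poly_Mapping.keys c \<subseteq> singular_simplex_set k X}"

definition gcycle_group :: "nat \<Rightarrow> 'g::ab_group_add itself \<Rightarrow> 'a topology \<Rightarrow> ('a, 'g) gchain monoid"
  where "gcycle_group k G X =
    \<lparr>carrier = {c \<in> gchains k X. gchain_boundary k c = 0}, monoid.mult = (+), one = 0\<rparr>"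

definition gboundaries :: "nat \<Rightarrow> 'g::ab_group_add itself \<Rightarrow> 'a topology \<Rightarrow> ('a, 'g) gchain set"
  where "gboundaries k G X = gchain_boundary (Suc k) ` gchains (Suc k) X"

definition ghomology :: "nat \<Rightarrow> 'g::ab_group_add itself \<Rightarrow> 'a topology \<Rightarrow> ('a, 'g) gchain set monoid"
  where "ghomology k G X = gcycle_group k G X Mod gboundaries k G X"

text \<open>
  All representatives of the H-map and of the homology class yield the same coset, so the union is
  that coset.
\<close>

definition ghomology_map ::
    "nat \<Rightarrow> 'g::ab_group_add itself \<Rightarrow> 'b topology \<Rightarrow> ('a \<Rightarrow> 'b) set
      \<Rightarrow> ('a, 'g) gchain set \<Rightarrow> ('b, 'g) gchain set"
  where "ghomology_map k G Y a z =
    (\<Union>f\<in>a. \<Union>c\<in>z. gboundaries k G Y #>\<^bsub>gcycle_group k G Y\<^esub> gchain_map k f c)"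


section \<open>Cech homology\<close>

definition inv_limit :: "('i, 'b monoid, 'b \<Rightarrow> 'b) inv_sys \<Rightarrow> ('i \<Rightarrow> 'b) monoid"
  where "inv_limit A = (product_group (idx A) (obj A))
    \<lparr>carrier := {x \<in> carrier (product_group (idx A) (obj A)).
      \<forall>i\<in>idx A. \<forall>j\<in>idx A. ile A i j \<longrightarrow> bond A i j (x j) = x i}\<rparr>"

definition inv_limit_map ::
    "('j, 'c monoid, 'c \<Rightarrow> 'c) inv_sys \<Rightarrow> ('j \<Rightarrow> 'b \<Rightarrow> 'c) \<times> ('j \<Rightarrow> 'i) \<Rightarrow> ('i \<Rightarrow> 'b) \<Rightarrow> ('j \<Rightarrow> 'c)"
  where "inv_limit_map B h x = (\<lambda>\<mu>\<in>idx B. fst h \<mu> (x (snd h \<mu>)))"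

definition homology_sys ::
    "nat \<Rightarrow> 'g::ab_group_add itself \<Rightarrow> ('i, 'a) top_sys
      \<Rightarrow> ('i, ('a, 'g) gchain set monoid, ('a, 'g) gchain set \<Rightarrow> ('a, 'g) gchain set) inv_sys"
  where "homology_sys k G S = \<lparr>idx = idx S, ile = ile S, obj = (\<lambda>i. ghomology k G (obj S i)),
    bond = (\<lambda>i j. ghomology_map k G (obj S i) (bond S i j))\<rparr>"

definition cech_homology ::
    "nat \<Rightarrow> 'g::ab_group_add itself \<Rightarrow> ('i, 'a) top_sys \<Rightarrow> ('i \<Rightarrow> ('a, 'g) gchain set) monoid"
  where "cech_homology k G S = inv_limit (homology_sys k G S)"

definition cech_map ::
    "nat \<Rightarrow> 'g::ab_group_add itself \<Rightarrow> ('j, 'a) top_sys \<Rightarrow> ('i, 'j, 'a) sys_mor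
      \<Rightarrow> ('i \<Rightarrow> ('a, 'g) gchain set) \<Rightarrow> ('j \<Rightarrow> ('a, 'g) gchain set)"
  where "cech_map k G T = (\<lambda>(f, \<phi>).
    inv_limit_map (homology_sys k G T) (\<lambda>\<mu>. ghomology_map k G (obj T \<mu>) (f \<mu>), \<phi>))"

end

theory Submission
  imports Defs
begin

text \<open>
  If \<open>F\<close> has shape dimension at most \<open>n\<close>, then for some representation each homomorphism
  \<open>H\<^sub>k(f\<^bsub>\<mu>\<lambda>\<^esub>)\<close> factors through \<open>H\<^sub>k(P; G)\<close> with \<open>dim P \<le> n < k\<close>, which vanishes; hence so does the
  induced map of the limits. The isomorphisms of the expansions carry this over to every other
  representation of \<open>F\<close>.

  For the vanishing of \<open>H\<^sub>k(P; G)\<close>: a singular cycle has compact support, so it lies in a finite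
  subcomplex \<open>L\<close>. Induct on the number of vertices of \<open>L\<close>. For a vertex \<open>v\<close> the open star
  \<open>{\<alpha>. \<alpha> v > 0}\<close> is contractible, the complement \<open>{\<alpha>. \<alpha> v < 1}\<close> of \<open>v\<close> deforms to the
  subcomplex of simplices without \<open>v\<close>, and the intersection deforms to the link of \<open>v\<close>, whose
  dimension is one less. The Mayer-Vietoris argument then gives the result.

  Homotopy invariance and subdivision for arbitrary coefficients are obtained by tensoring natural
  operators on integral chains with \<open>G\<close>.
\<close>

section \<open>Chains with coefficients\<close>

text \<open>The geometry takes place in barycentric coordinates with the product topology, where
  straight-line homotopies are continuous because each coordinate is. The weak topology of an
  infinite complex may be strictly finer, so the passage to a finite subcomplex has to come before
  any deformation. Homology is unreduced, and a point already has homology in degree 0. Counting the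
  vertices of a simplex instead of its dimension, with the invariant
  \<open>card \<sigma> \<le> n\<close> and \<open>n \<le> k\<close>, makes the empty complex the
  base case and lets the link lose one vertex while the degree drops by one. Maps that agree on
  integral homology can differ on homology with coefficients. What survives the change of
  coefficients is an identity between additive operators on integral chains, such as a chain
  homotopy, because it can be checked on generators. This is why explicit operators are carried
  along instead of mere statements about homology classes.\<close>

definition zmul :: "int \<Rightarrow> 'g::ab_group_add \<Rightarrow> 'g"
  where "zmul n g = (\<Sum>i<nat n. g) - (\<Sum>i<nat (- n). g)"

lemma sum_const_lessThan_add: "(\<Sum>i<b + d. g) = (\<Sum>i<b. g) + (\<Sum>i<d. g)"
  for b d :: nat and g :: "'g::ab_group_add"
  by (induction d) (simp_all add: add.assoc)

text \<open>Writing an integer as a difference of naturals avoids case distinctions on signs later: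
  cancellation of common summands is dealt with here, and additivity of \<open>zmul\<close> in the
  integer then amounts to counting summands.\<close>

lemma zmul_diff_of_nat: "zmul (int a - int b) g = (\<Sum>i<a. g) - (\<Sum>i<b. g)"
proof (cases "b \<le> a")
  case True
  then obtain d where "a = b + d" using le_Suc_ex by blast
  then show ?thesis by (simp add: zmul_def sum_const_lessThan_add)
next
  case False
  then obtain d where "b = a + d" using le_Suc_ex[of a b] by auto
  then show ?thesis by (simp add: zmul_def sum_const_lessThan_add)
qed

lemma zmul_0 [simp]: "zmul 0 g = 0"
  and zmul_1 [simp]: "zmul 1 g = g"
  and zmul_minus_1 [simp]: "zmul (-1) g = - g"
  by (simp_all add: zmul_def)

lemma zmul_add_left: "zmul (m + n) g = zmul m g + zmul n g"
proof -
  obtain a b c d where mn: "m = int a - int b" "n = int c - int d"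
    by (metis int_diff_cases)
  have "m + n = int (a + c) - int (b + d)"
    by (simp add: mn)
  then have "zmul (m + n) g = (\<Sum>i<a + c. g) - (\<Sum>i<b + d. g)"
    by (simp only: zmul_diff_of_nat)
  then show ?thesis
    by (simp add: mn zmul_diff_of_nat sum_const_lessThan_add)
qed

lemma zmul_add_right: "zmul m (g + h) = zmul m g + zmul m h"
  by (simp add: zmul_def sum.distrib)

lemma zmul_minus_left: "zmul (- m) g = - zmul m g"
  by (simp add: zmul_def)

lemma zmul_diff_left: "zmul (m - n) g = zmul m g - zmul n g"
  using zmul_add_left[of m "- n" g] by (simp add: zmul_minus_left)

lemma zmul_0_right [simp]: "zmul m 0 = 0"
  by (simp add: zmul_def)

lemma zmul_mult: "zmul (m * n) g = zmul m (zmul n g)"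
proof -
  have nat: "zmul (int a * n) g = zmul (int a) (zmul n g)" for a
    by (induction a) (simp_all add: distrib_right zmul_add_left)
  obtain a b where m: "m = int a - int b"
    by (metis int_diff_cases)
  show ?thesis
    by (simp add: m left_diff_distrib zmul_diff_left nat)
qed

text \<open>The elementary tensor of \<open>c\<close> and \<open>g\<close>: finitely supported
  functions into \<open>'g\<close> are the tensor product of the integral chains with
  \<open>'g\<close>.\<close>

definition gten :: "'g::ab_group_add \<Rightarrow> ('a \<Rightarrow>\<^sub>0 int) \<Rightarrow> ('a \<Rightarrow>\<^sub>0 'g)"
  where "gten g = Poly_Mapping.map (\<lambda>n. zmul n g)"

lemma lookup_gten [simp]: "Poly_Mapping.lookup (gten g c) s = zmul (Poly_Mapping.lookup c s) g"
  by (simp add: gten_def Poly_Mapping.map.rep_eq when_def in_keys_iff)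

lemma keys_gten: "Poly_Mapping.keys (gten g c) \<subseteq> Poly_Mapping.keys c"
  by (auto simp: in_keys_iff)

lemma gten_add: "gten g (c + d) = gten g c + gten g d"
  and gten_add_left: "gten (g + h) c = gten g c + gten h c"
  and gten_0 [simp]: "gten 0 c = 0"
  and gten_0_right [simp]: "gten g 0 = 0"
  and gten_diff: "gten g (c - d) = gten g c - gten g d"
  by (rule poly_mapping_eqI, simp add: lookup_add lookup_minus zmul_add_left zmul_add_right
        zmul_diff_left)+

lemma gten_cmul: "gten g (frag_cmul n c) = gten (zmul n g) c"
proof (rule poly_mapping_eqI)
  show "Poly_Mapping.lookup (gten g (frag_cmul n c)) s = Poly_Mapping.lookup (gten (zmul n g) c) s" for s
    using zmul_mult[of "Poly_Mapping.lookup c s" n g] by (simp add: mult.commute)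
qed

lemma gten_frag_of [simp]: "gten g (frag_of s) = Poly_Mapping.single s g"
  by (rule poly_mapping_eqI) (simp add: lookup_single when_def)

lemma gten_sum: "gten g (sum f A) = (\<Sum>i\<in>A. gten g (f i))"
  by (induction A rule: infinite_finite_induct) (simp_all add: gten_add)

section \<open>Extension of integral operators to chains with coefficients\<close>

definition gext :: "('a \<Rightarrow> ('b \<Rightarrow>\<^sub>0 int)) \<Rightarrow> ('a \<Rightarrow>\<^sub>0 'g::ab_group_add) \<Rightarrow> ('b \<Rightarrow>\<^sub>0 'g)"
  where "gext \<Phi> c = (\<Sum>s\<in>Poly_Mapping.keys c. gten (Poly_Mapping.lookup c s) (\<Phi> s))"

text \<open>Coefficients can cancel, so the support of a sum may be smaller than the union of the
  supports. Additivity of \<open>gext\<close> is therefore obtained by summing over a common finite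
  superset.\<close>

lemma gext_superset:
  assumes "finite A" "Poly_Mapping.keys c \<subseteq> A"
  shows "gext \<Phi> c = (\<Sum>s\<in>A. gten (Poly_Mapping.lookup c s) (\<Phi> s))"
  unfolding gext_def using assms
  by (intro sum.mono_neutral_left) (auto simp: in_keys_iff)

lemma gext_add: "gext \<Phi> (c + d) = gext \<Phi> c + gext \<Phi> d"
proof -
  let ?A = "Poly_Mapping.keys c \<union> Poly_Mapping.keys d"
  have "Poly_Mapping.keys (c + d) \<subseteq> ?A"
    by (rule keys_add)
  then show ?thesis
    using gext_superset[of ?A "c + d" \<Phi>] gext_superset[of ?A c \<Phi>] gext_superset[of ?A d \<Phi>]
    by (simp add: lookup_add gten_add_left sum.distrib)
qed

lemma gext_0 [simp]: "gext \<Phi> 0 = 0"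
  by (simp add: gext_def)

lemma gext_minus: "gext \<Phi> (- c) = - gext \<Phi> c"
  using gext_add[of \<Phi> "- c" c] by (intro eq_neg_iff_add_eq_0[THEN iffD2]) simp

lemma gext_diff: "gext \<Phi> (c - d) = gext \<Phi> c - gext \<Phi> d"
  using gext_add[of \<Phi> c "- d"] by (simp add: gext_minus)

lemma gext_sum: "gext \<Phi> (sum f A) = (\<Sum>i\<in>A. gext \<Phi> (f i))"
  by (induction A rule: infinite_finite_induct) (simp_all add: gext_add)

lemma gext_single [simp]: "gext \<Phi> (Poly_Mapping.single s g) = gten g (\<Phi> s)"
  by (simp add: gext_superset[of "{s}"])

lemma gext_gten: "gext \<Phi> (gten g c) = gten g (frag_extend \<Phi> c)"
proof -
  have "gext \<Phi> (gten g c) = (\<Sum>s\<in>Poly_Mapping.keys c. gten (zmul (Poly_Mapping.lookup c s) g) (\<Phi> s))"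
    by (subst gext_superset[of "Poly_Mapping.keys c"]) (simp_all add: keys_gten)
  then show ?thesis
    by (simp add: frag_extend_def gten_sum gten_cmul)
qed

lemma gext_gext: "gext \<Phi> (gext \<Psi> c) = gext (\<lambda>s. frag_extend \<Phi> (\<Psi> s)) c"
  by (simp add: gext_def[of \<Psi>] gext_sum gext_gten) (simp add: gext_def)

lemma gext_cong: "(\<And>s. s \<in> Poly_Mapping.keys c \<Longrightarrow> \<Phi> s = \<Psi> s) \<Longrightarrow> gext \<Phi> c = gext \<Psi> c"
  by (simp add: gext_def)

lemma keys_gext:
  "Poly_Mapping.keys (gext \<Phi> c) \<subseteq> (\<Union>s\<in>Poly_Mapping.keys c. Poly_Mapping.keys (\<Phi> s))"
  unfolding gext_def
  by (intro order_trans[OF keys_sum] UN_mono subset_refl keys_gten)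

lemma gext_frag_of [simp]: "gext frag_of c = c"
proof -
  have "Poly_Mapping.lookup (\<Sum>i\<in>I. Poly_Mapping.single i (Poly_Mapping.lookup c i)) j =
      (if j \<in> I then Poly_Mapping.lookup c j else 0)" if "finite I" for I j
    using that by (induction I) (auto simp: lookup_single lookup_add when_def)
  then show ?thesis
    by (intro poly_mapping_eqI) (simp add: gext_def in_keys_iff)
qed

text \<open>For additive \<open>T\<close> this is \<open>T \<otimes> G\<close>; only the values of \<open>T\<close> on generators enter.\<close>

definition glift :: "(('a \<Rightarrow>\<^sub>0 int) \<Rightarrow> ('b \<Rightarrow>\<^sub>0 int)) \<Rightarrow> ('a \<Rightarrow>\<^sub>0 'g::ab_group_add) \<Rightarrow> ('b \<Rightarrow>\<^sub>0 'g)"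
  where "glift T = gext (\<lambda>s. T (frag_of s))"

text \<open>An additive operator is recovered from its values on generators, which are all that
  \<open>glift\<close> sees. The hypothesis speaks of differences because
  \<open>frag_induction\<close> builds chains from generators by subtraction.\<close>

lemma frag_extend_additive:
  assumes "\<And>a b. T (a - b) = T a - T b"
  shows "frag_extend (\<lambda>s. T (frag_of s)) c = T c"
proof -
  have T0: "T 0 = 0"
    using assms[of 0 0] by simp
  show ?thesis
    using subset_UNIV[of "Poly_Mapping.keys c"]
    by (induction c rule: frag_induction) (auto simp: frag_extend_diff assms T0)
qed

text \<open>The outer operator meets \<open>U (frag_of s)\<close>, a chain rather than a generator;
  additivity of \<open>T\<close> determines its value there.\<close>

lemma glift_glift:
  assumes "\<And>a b. T (a - b) = T a - T b"
  shows "glift T (glift U c) = glift (\<lambda>x. T (U x)) c"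
  by (simp add: glift_def gext_gext frag_extend_additive[of T, OF assms])

lemma glift_cong:
  "(\<And>s. s \<in> Poly_Mapping.keys c \<Longrightarrow> T (frag_of s) = U (frag_of s)) \<Longrightarrow> glift T c = glift U c"
  by (auto simp: glift_def intro: gext_cong)

lemma glift_add: "glift T (c + d) = glift T c + glift T d"
  and glift_diff: "glift T (c - d) = glift T c - glift T d"
  and glift_minus: "glift T (- c) = - glift T c"
  and glift_0 [simp]: "glift T 0 = 0"
  and glift_id: "glift (\<lambda>x. x) c = c"
  by (simp_all add: glift_def gext_add gext_diff gext_minus)

lemma glift_plus: "glift (\<lambda>x. T x + U x) c = glift T c + glift U c"
  and glift_sub: "glift (\<lambda>x. T x - U x) c = glift T c - glift U c"
  and glift_zero: "glift (\<lambda>x. 0) c = 0"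
  by (simp_all add: glift_def gext_def gten_add gten_diff sum.distrib sum_subtractf)

lemma keys_glift:
  "Poly_Mapping.keys (glift T c) \<subseteq> (\<Union>s\<in>Poly_Mapping.keys c. Poly_Mapping.keys (T (frag_of s)))"
  unfolding glift_def by (rule keys_gext)

section \<open>Boundaries and chain maps inherited from integral chains\<close>

lemma gchain_boundary_eq_glift: "gchain_boundary k c = glift (chain_boundary k) c"
proof (cases "k = 0")
  case True
  then show ?thesis
    by (simp add: gchain_boundary_def glift_def chain_boundary_def gext_def)
next
  case False
  have cmul: "gten g (frag_cmul ((-1) ^ i) (frag_of s)) = Poly_Mapping.single s (if even i then g else - g)"
    for g :: 'b and i :: nat and s :: "(nat \<Rightarrow> real) \<Rightarrow> 'a"
    by (simp add: gten_cmul)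
  show ?thesis
    using False
    by (simp add: gchain_boundary_def glift_def chain_boundary_def gext_def gten_sum cmul
        cong: if_cong)
qed

lemma gchain_map_eq_glift: "gchain_map k f c = glift (chain_map k f) c"
  by (simp add: gchain_map_def glift_def gext_def)

lemma glift_in_gchains:
  assumes "c \<in> gchains p X" "\<And>s. singular_simplex p X s \<Longrightarrow> singular_chain q Y (T (frag_of s))"
  shows "glift T c \<in> gchains q Y"
proof -
  have "Poly_Mapping.keys (T (frag_of s)) \<subseteq> singular_simplex_set q Y"
    if "s \<in> Poly_Mapping.keys c" for s
    using assms that by (auto simp: gchains_def singular_chain_def)
  then show ?thesis
    unfolding gchains_def using keys_glift[of T c] by blast
qed

text \<open>The transfer principle: an identity of integral operators, checked on single simplices
  of \<open>X\<close>, becomes an identity on chains of \<open>X\<close> with coefficients.\<close>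

lemma glift_cong_gchains:
  assumes "c \<in> gchains p X" "\<And>s. singular_simplex p X s \<Longrightarrow> T (frag_of s) = U (frag_of s)"
  shows "glift T c = glift U c"
  using assms by (intro glift_cong) (auto simp: gchains_def)

lemma gchains_0 [simp]: "0 \<in> gchains p X"
  by (simp add: gchains_def)

lemma gchains_add: "c \<in> gchains p X \<Longrightarrow> d \<in> gchains p X \<Longrightarrow> c + d \<in> gchains p X"
  using keys_add[of c d] by (auto simp: gchains_def)

lemma gchains_minus [simp]: "- c \<in> gchains p X \<longleftrightarrow> c \<in> gchains p X"
  by (simp add: gchains_def in_keys_iff subset_iff)

lemma gchains_diff: "c \<in> gchains p X \<Longrightarrow> d \<in> gchains p X \<Longrightarrow> c - d \<in> gchains p X"
  using gchains_add[of c p X "- d"] by simp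

lemma gchain_boundary_add: "gchain_boundary k (c + d) = gchain_boundary k c + gchain_boundary k d"
  and gchain_boundary_diff: "gchain_boundary k (c - d) = gchain_boundary k c - gchain_boundary k d"
  and gchain_boundary_minus: "gchain_boundary k (- c) = - gchain_boundary k c"
  and gchain_boundary_zero [simp]: "gchain_boundary k 0 = 0"
  by (simp_all add: gchain_boundary_eq_glift glift_add glift_diff glift_minus)

lemma gchain_map_add: "gchain_map k f (c + d) = gchain_map k f c + gchain_map k f d"
  and gchain_map_zero [simp]: "gchain_map k f 0 = 0"
  by (simp_all add: gchain_map_eq_glift glift_add)

lemma gchain_boundary_in_gchains:
  "c \<in> gchains p X \<Longrightarrow> gchain_boundary p c \<in> gchains (p - Suc 0) X"
  unfolding gchain_boundary_eq_glift
  by (erule glift_in_gchains) (simp add: singular_chain_boundary singular_chain_of)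

lemma gchain_boundary_boundary:
  assumes "c \<in> gchains p X"
  shows "gchain_boundary (p - Suc 0) (gchain_boundary p c) = 0"
proof -
  have "glift (\<lambda>x. chain_boundary (p - Suc 0) (chain_boundary p x)) c = glift (\<lambda>x. 0) c"
    using assms by (rule glift_cong_gchains)
      (simp add: chain_boundary_boundary[where X = X] singular_chain_of)
  then show ?thesis
    by (simp add: gchain_boundary_eq_glift glift_glift chain_boundary_diff glift_zero)
qed

lemma gchain_map_in_gchains:
  "c \<in> gchains p X \<Longrightarrow> continuous_map X Y f \<Longrightarrow> gchain_map p f c \<in> gchains p Y"
  unfolding gchain_map_eq_glift
  by (erule glift_in_gchains) (simp add: singular_simplex_simplex_map singular_chain_of)

lemma gchain_boundary_map:
  assumes "c \<in> gchains p X"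
  shows "gchain_boundary p (gchain_map p f c) = gchain_map (p - Suc 0) f (gchain_boundary p c)"
proof -
  have "glift (\<lambda>x. chain_boundary p (chain_map p f x)) c =
      glift (\<lambda>x. chain_map (p - Suc 0) f (chain_boundary p x)) c"
    using assms by (rule glift_cong_gchains)
      (simp add: chain_boundary_chain_map[where X = X] singular_chain_of del: chain_map_of)
  then show ?thesis
    by (simp add: gchain_boundary_eq_glift gchain_map_eq_glift glift_glift chain_boundary_diff
        chain_map_diff)
qed

lemma gchain_map_compose: "gchain_map p (g \<circ> f) c = gchain_map p g (gchain_map p f c)"
  by (simp only: gchain_map_eq_glift glift_glift chain_map_diff chain_map_compose) (simp add: o_def)

lemma gchain_map_ident:
  assumes "c \<in> gchains p X" "\<And>x. x \<in> topspace X \<Longrightarrow> f x = x"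
  shows "gchain_map p f c = c"
proof -
  have "glift (chain_map p f) c = glift (\<lambda>x. x) c"
    using assms(1) by (rule glift_cong_gchains) (simp add: simplex_map_id_gen[OF _ assms(2)])
  then show ?thesis
    by (simp add: gchain_map_eq_glift glift_id)
qed


section \<open>Homotopy invariance\<close>

text \<open>Continuity into a product is checked coordinatewise, and each coordinate of the straight
  line is a polynomial expression in continuous functions. \<open>A\<close> need not be convex, as
  long as these particular segments stay in it. The deformations of simplices and polyhedra below
  are instances.\<close>

lemma homotopic_with_powertop_linear:
  assumes f: "continuous_map X (powertop_real UNIV) f" and g: "continuous_map X (powertop_real UNIV) g"
    and A: "\<And>x t. x \<in> topspace X \<Longrightarrow> 0 \<le> t \<Longrightarrow> t \<le> 1 \<Longrightarrow> (\<lambda>i. (1 - t) * f x i + t * g x i) \<in> A"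
  shows "homotopic_with (\<lambda>_. True) X (subtopology (powertop_real UNIV) A) f g"
proof -
  let ?P = "prod_topology (top_of_set {0..1::real}) X"
  have t: "continuous_map ?P euclideanreal fst"
    by (rule continuous_map_into_fulltopology[OF continuous_map_fst])
  have fx: "continuous_map ?P euclideanreal (\<lambda>y. f (snd y) i)"
    and gx: "continuous_map ?P euclideanreal (\<lambda>y. g (snd y) i)" for i
    using continuous_map_compose[OF continuous_map_snd[of "top_of_set {0..1::real}"] f]
      continuous_map_compose[OF continuous_map_snd[of "top_of_set {0..1::real}"] g]
    by (simp_all add: continuous_map_componentwise_UNIV o_def)
  have "continuous_map ?P (subtopology (powertop_real UNIV) A)
      (\<lambda>y i. (1 - fst y) * f (snd y) i + fst y * g (snd y) i)"
    unfolding continuous_map_in_subtopology continuous_map_componentwise_UNIV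
    using A by (auto intro!: continuous_intros t fx gx)
  then show ?thesis
    unfolding homotopic_with_def
    by (intro exI[of _ "\<lambda>y i. (1 - fst y) * f (snd y) i + fst y * g (snd y) i"]) simp
qed

text \<open>The contraction makes \<open>c\<close> homologous to its image in a single point, which
  bounds because the degree is positive. Being about integral chains, this can precede homotopy
  invariance with coefficients, whose proof uses it to choose fillings.\<close>

lemma contractible_space_cycle_boundary:
  assumes "contractible_space X" "0 < p" "singular_chain p X c" "chain_boundary p c = 0"
  obtains d where "singular_chain (Suc p) X d" "chain_boundary (Suc p) d = c"
proof (cases "topspace X = {}")
  case True
  then show thesis
    using assms(3) that[of 0] by (simp add: singular_chain_empty)
next
  case False
  obtain a where hom: "homotopic_with (\<lambda>_. True) X X id (\<lambda>_. a)"
    using assms(1) by (auto simp: contractible_space_def)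
  have cyc: "singular_relcycle p X {} c"
    using assms by (simp add: singular_cycle)
  have aX: "a \<in> topspace X"
    using homotopic_with_imp_continuous_maps[OF hom] False by (auto simp: continuous_map_def)
  have "homotopic_with (\<lambda>h. h \<in> {} \<rightarrow> {}) X X id (\<lambda>_. a)"
    by (rule homotopic_with_mono[OF hom]) auto
  then have rel: "homologous_rel p X {} (chain_map p id c) (chain_map p (\<lambda>_. a) c)"
    using cyc by (rule homotopic_imp_homologous_rel_chain_maps)
  have "chain_map p id c = c"
    using assms(3) by (simp add: chain_map_id_gen)
  have "singular_relcycle p (subtopology X {a}) {} (chain_map p (\<lambda>_. a) c)"
    by (rule singular_relcycle_chain_map[OF cyc]) (auto simp: aX continuous_map_in_subtopology)
  then have "singular_relboundary p (subtopology X {a}) {} (chain_map p (\<lambda>_. a) c)"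
    using singular_boundary_eq_cycle_singleton[of "subtopology X {a}" a p] aX assms(2)
    by (auto simp: topspace_subtopology)
  then have "singular_relboundary p X {} (chain_map p (\<lambda>_. a) c)"
    using singular_boundary_mono[of "{a}" UNIV p X] by simp
  then have "singular_relboundary p X {} c"
    using rel \<open>chain_map p id c = c\<close> singular_relboundary_add[of p X "{}" "c - chain_map p (\<lambda>_. a) c"]
    by (fastforce simp: homologous_rel_def)
  then show thesis
    using that by (auto simp: singular_boundary)
qed

section \<open>Prism operators\<close>

abbreviation simplex_space :: "nat \<Rightarrow> (nat \<Rightarrow> real) topology"
  where "simplex_space q \<equiv> subtopology (powertop_real UNIV) (standard_simplex q)"

abbreviation cylinder :: "'a topology \<Rightarrow> (real \<times> 'a) topology"
  where "cylinder X \<equiv> prod_topology (top_of_set {0..1}) X"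

text \<open>Singular simplices are extensional functions, hence the restriction. This is the
  universal singular simplex: every \<open>s\<close> is its image under the map
  \<open>s\<close>.\<close>

abbreviation simplex_id :: "nat \<Rightarrow> (nat \<Rightarrow> real) \<Rightarrow> (nat \<Rightarrow> real)"
  where "simplex_id q \<equiv> restrict id (standard_simplex q)"

lemma contractible_space_cylinder_simplex: "contractible_space (cylinder (simplex_space q))"
proof -
  obtain a where a: "a \<in> standard_simplex q"
    using nonempty_standard_simplex by blast
  have "homotopic_with (\<lambda>_. True) (simplex_space q) (simplex_space q) id (\<lambda>_. a)"
  proof (rule homotopic_with_powertop_linear)
    show "(\<lambda>i. (1 - t) * id x i + t * a i) \<in> standard_simplex q"
      if "x \<in> topspace (simplex_space q)" "0 \<le> t" "t \<le> 1" for x t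
      using convex_standard_simplex[of x q a t] that a by (simp add: topspace_subtopology)
  qed (simp_all add: continuous_map_from_subtopology)
  then have "contractible_space (simplex_space q)"
    by (auto simp: contractible_space_def)
  moreover have "contractible_space (top_of_set {0..1::real})"
    by (simp add: convex_imp_contractible contractible_space_top_of_set is_interval_convex_1)
  ultimately show ?thesis
    by (simp add: contractible_space_prod_topology)
qed

text \<open>
  The library proves that homotopic maps agree on integral homology but does not export the chain
  homotopy, which is what passes to other coefficients. It is rebuilt here by acyclic models: a chain
  \<open>m q\<close> on the cylinder over the standard \<open>q\<close>-simplex is chosen inductively, and naturality
  determines the homotopy on every space.
\<close>

definition slice_map :: "('a \<Rightarrow> 'b) \<Rightarrow> real \<times> 'a \<Rightarrow> real \<times> 'b"
  where "slice_map s = (\<lambda>(t, x). (t, s x))"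

text \<open>Naturality is built in: the prism on a simplex \<open>s\<close> is the image of the
  model \<open>m\<close> under the map of cylinders induced by \<open>s\<close>, extended
  additively.\<close>

definition prism_ext ::
    "nat \<Rightarrow> (real \<times> (nat \<Rightarrow> real)) chain \<Rightarrow> 'a chain \<Rightarrow> (real \<times> 'a) chain"
  where "prism_ext q m = frag_extend (\<lambda>s. chain_map (Suc q) (slice_map s) m)"

lemma prism_ext_diff: "prism_ext q m (a - b) = prism_ext q m a - prism_ext q m b"
  and prism_ext_0 [simp]: "prism_ext q m 0 = 0"
  and prism_ext_of: "prism_ext q m (frag_of s) = chain_map (Suc q) (slice_map s) m"
  by (simp_all add: prism_ext_def frag_extend_diff)

lemma continuous_map_slice_map:
  assumes "singular_simplex q X s"
  shows "continuous_map (cylinder (simplex_space q)) (cylinder X) (slice_map s)"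
  unfolding slice_map_def case_prod_unfold
  using assms continuous_map_compose[OF continuous_map_snd, of "simplex_space q" X s "top_of_set {0..1::real}"]
  by (intro continuous_map_pairedI) (auto simp: singular_simplex_def continuous_map_fst o_def)

lemma singular_chain_prism_ext:
  assumes "singular_chain (Suc q) (cylinder (simplex_space q)) m" "singular_chain q X c"
  shows "singular_chain (Suc q) (cylinder X) (prism_ext q m c)"
  unfolding prism_ext_def
proof (rule singular_chain_extend)
  fix s assume "s \<in> Poly_Mapping.keys c"
  then have "singular_simplex q X s"
    using assms(2) by (auto simp: singular_chain_def)
  then show "singular_chain (Suc q) (cylinder X) (chain_map (Suc q) (slice_map s) m)"
    by (intro singular_chain_chain_map[OF assms(1)] continuous_map_slice_map)
qed

lemma prism_ext_natural:
  assumes m: "singular_chain (Suc q) (cylinder (simplex_space q)) m" 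
  shows "prism_ext q m (chain_map q g c) = chain_map (Suc q) (slice_map g) (prism_ext q m c)"
  using subset_UNIV[of "Poly_Mapping.keys c"]
proof (induction c rule: frag_induction)
  case (one s)
  \<comment> \<open>\<open>simplex_map\<close> restricts \<open>g \<circ> s\<close> to the standard
    simplex, so the two maps agree only on the cylinder over it; that is where \<open>m\<close>
    lives.\<close>
  have "chain_map (Suc q) (slice_map (simplex_map q g s)) m =
      chain_map (Suc q) (slice_map g \<circ> slice_map s) m"
    by (rule chain_map_eq[OF m]) (auto simp: slice_map_def simplex_map_def topspace_subtopology)
  then show ?case
    by (simp add: prism_ext_of chain_map_compose)
qed (simp_all add: prism_ext_diff chain_map_diff)

lemma singular_simplex_simplex_id: "singular_simplex q (simplex_space q) (simplex_id q)"
  unfolding singular_simplex_def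
  by (auto intro: continuous_map_eq[OF continuous_map_id])

lemma continuous_map_bottom_top:
  "t \<in> {0..1} \<Longrightarrow> continuous_map X (cylinder X) (Pair t)"
  by (intro continuous_map_pairedI) auto

text \<open>\<open>m\<close> is the model in degree \<open>q - 1\<close>; it is irrelevant for \<open>q = 0\<close>, where the boundary is zero.\<close>

definition prism_eq :: "nat \<Rightarrow> (real \<times> (nat \<Rightarrow> real)) chain \<Rightarrow> (real \<times> (nat \<Rightarrow> real)) chain \<Rightarrow> 'a chain \<Rightarrow> bool"
  where "prism_eq q m m' c \<longleftrightarrow>
    chain_boundary (Suc q) (prism_ext q m' c) + prism_ext (q - 1) m (chain_boundary q c) =
      chain_map q (Pair 1) c - chain_map q (Pair 0) c"

lemma prism_ext_simplex_id:
  assumes "singular_chain (Suc q) (cylinder (simplex_space q)) m"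
  shows "prism_ext q m (frag_of (simplex_id q)) = m"
  unfolding prism_ext_of
  by (rule chain_map_id_gen[OF assms]) (auto simp: slice_map_def topspace_subtopology)

text \<open>Each generator \<open>s\<close> of \<open>c\<close> is the image of the identity simplex
  under \<open>s\<close>, and every term of \<open>prism_eq\<close> is natural, so pushing the model
  equation forward along \<open>slice_map s\<close> gives the equation for \<open>s\<close>.\<close>

lemma prism_eq_from_model:
  assumes m: "0 < q \<Longrightarrow> singular_chain q (cylinder (simplex_space (q - 1))) m"
    and m': "singular_chain (Suc q) (cylinder (simplex_space q)) m'"
    and eq: "prism_eq q m m' (frag_of (simplex_id q))"
    and c: "singular_chain q X c"
  shows "prism_eq q m m' c"
  using c[unfolded singular_chain_def]
proof (induction c rule: frag_induction)
  case (one s)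
  then have s: "singular_simplex q X s"
    by simp
  let ?i = "frag_of (simplex_id q)"
  have i: "singular_chain q (simplex_space q) ?i"
    by (simp add: singular_chain_of singular_simplex_simplex_id)
  have s_eq: "frag_of s = chain_map q s ?i"
    using singular_simplex_chain_map_id[OF s] by simp
  have "chain_boundary (Suc q) (prism_ext q m' (frag_of s)) =
      chain_map q (slice_map s) (chain_boundary (Suc q) (prism_ext q m' ?i))"
    using chain_boundary_chain_map[OF m'] by (simp add: prism_ext_of[of _ _ s] prism_ext_simplex_id[OF m'])
  moreover have "prism_ext (q - 1) m (chain_boundary q (frag_of s)) =
      chain_map q (slice_map s) (prism_ext (q - 1) m (chain_boundary q ?i))"
  proof (cases q)
    case 0
    then show ?thesis
      by (simp add: chain_boundary_def)
  next
    case (Suc r)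
    then show ?thesis
      unfolding s_eq using chain_boundary_chain_map[OF i, of s] prism_ext_natural[of r m] m by simp
  qed
  moreover have "chain_map q (slice_map s) (chain_map q (Pair t) ?i) = chain_map q (Pair t) (frag_of s)"
    for t
  proof -
    have "slice_map s \<circ> Pair t = Pair t \<circ> s"
      by (auto simp: slice_map_def)
    then show ?thesis
      unfolding s_eq by (metis chain_map_compose comp_apply)
  qed
  ultimately show ?case
    using arg_cong[OF eq[unfolded prism_eq_def], of "chain_map q (slice_map s)"]
    by (simp only: prism_eq_def chain_map_add chain_map_diff)
next
  case (diff a b)
  then show ?case
    by (simp add: prism_eq_def prism_ext_diff chain_map_diff chain_boundary_diff algebra_simps)
qed (simp_all add: prism_eq_def)

lemma prism_model_0:
  obtains m where "singular_chain 1 (cylinder (simplex_space 0)) m"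
    "\<And>m'. prism_eq 0 m' m (frag_of (simplex_id 0))"
proof -
  define e :: "nat \<Rightarrow> real" where "e = (\<lambda>j. if j = 0 then 1 else 0)"
  \<comment> \<open>the segment joining the two ends of the cylinder over a point\<close>
  define \<sigma> where "\<sigma> = restrict (\<lambda>x :: nat \<Rightarrow> real. (x 1, e)) (standard_simplex 1)"
  have e: "standard_simplex 0 = {e}" 
    by (simp add: e_def standard_simplex_0)
  have "singular_simplex 1 (cylinder (simplex_space 0)) \<sigma>"
    unfolding singular_simplex_def
  proof
    have "continuous_map (simplex_space 1) (cylinder (simplex_space 0)) (\<lambda>x. (x 1, e))"
    proof (rule continuous_map_pairedI)
      show "continuous_map (simplex_space 1) (top_of_set {0..1::real}) (\<lambda>x. x 1)"
        by (auto simp: continuous_map_in_subtopology standard_simplex_def topspace_subtopology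
            intro: continuous_map_from_subtopology continuous_map_product_projection)
    qed (simp add: e topspace_subtopology)
    then show "continuous_map (simplex_space 1) (cylinder (simplex_space 0)) \<sigma>"
      by (rule continuous_map_eq) (simp add: \<sigma>_def topspace_subtopology)
  qed (simp add: \<sigma>_def)
  then have chain: "singular_chain 1 (cylinder (simplex_space 0)) (frag_of \<sigma>)"
    by (simp add: singular_chain_of)
  \<comment> \<open>Face 0 omits vertex 0 and so ends where coordinate 1 equals 1, at the top. This
    orientation accounts for the plus sign of \<open>Pair 1\<close> in
    \<open>prism_eq\<close>.\<close>
  have faces: "simplical_face 0 e 1 = 1" "simplical_face (Suc 0) e 1 = 0"
    by (simp_all add: simplical_face_def e_def)
  have in1: "simplical_face 0 e \<in> standard_simplex 1" "simplical_face (Suc 0) e \<in> standard_simplex 1"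
    using simplical_face_in_standard_simplex[of 1 0 e] simplical_face_in_standard_simplex[of 1 1 e]
    by (simp_all add: e)
  have "chain_boundary 1 (frag_of \<sigma>) = frag_of (singular_face 1 0 \<sigma>) - frag_of (singular_face 1 1 \<sigma>)"
    by (simp add: chain_boundary_of)
  moreover have "singular_face 1 0 \<sigma> x = simplex_map 0 (Pair 1) (simplex_id 0) x"
    and "singular_face 1 1 \<sigma> x = simplex_map 0 (Pair 0) (simplex_id 0) x" for x
    using in1 faces by (cases "x = e"; simp add: singular_face_def simplex_map_def \<sigma>_def e)+
  then have "singular_face 1 0 \<sigma> = simplex_map 0 (Pair 1) (simplex_id 0)"
    "singular_face 1 1 \<sigma> = simplex_map 0 (Pair 0) (simplex_id 0)"
    by blast+
  ultimately have "prism_eq 0 m' (frag_of \<sigma>) (frag_of (simplex_id 0))" for m'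
    using prism_ext_simplex_id[of 0 "frag_of \<sigma>"] chain
    by (simp add: prism_eq_def chain_boundary_def[of 0])
  then show thesis
    using chain that by blast
qed

text \<open>The equation prescribes the boundary of \<open>m'\<close>, namely \<open>?z\<close>. The
  equation one degree lower, applied to the boundary of the identity simplex, shows that
  \<open>?z\<close> is a cycle; the contractible cylinder then supplies a filling, since the degree
  is positive.\<close>

lemma prism_model_Suc:
  assumes m: "singular_chain (Suc q) (cylinder (simplex_space q)) m"
    and R: "\<And>d. singular_chain (Suc q) (simplex_space (Suc q)) d \<Longrightarrow> prism_eq q m0 m (chain_boundary (Suc q) d)"
  obtains m' where "singular_chain (Suc (Suc q)) (cylinder (simplex_space (Suc q))) m'"
    "prism_eq (Suc q) m m' (frag_of (simplex_id (Suc q)))"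
proof -
  let ?i = "frag_of (simplex_id (Suc q))"
  let ?S = "simplex_space (Suc q)"
  let ?z = "chain_map (Suc q) (Pair 1) ?i - chain_map (Suc q) (Pair 0) ?i -
    prism_ext q m (chain_boundary (Suc q) ?i)"
  have i: "singular_chain (Suc q) ?S ?i"
    by (simp add: singular_chain_of singular_simplex_simplex_id)
  have bi: "singular_chain q ?S (chain_boundary (Suc q) ?i)"
    using singular_chain_boundary[OF i] by simp
  have bbi: "chain_boundary q (chain_boundary (Suc q) ?i) = 0"
    using chain_boundary_boundary[OF i] by simp
  have "singular_chain (Suc q) (cylinder ?S) (chain_map (Suc q) (Pair t) ?i)" if "t \<in> {0..1}" for t
    by (rule singular_chain_chain_map[OF i]) (rule continuous_map_bottom_top[OF that])
  then have "singular_chain (Suc q) (cylinder ?S) ?z"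
    by (intro singular_chain_diff singular_chain_prism_ext[OF m] bi) auto
  moreover have "chain_boundary (Suc q) ?z = 0"
    using R[OF i] chain_boundary_chain_map[OF i, of "Pair (1::real)"]
      chain_boundary_chain_map[OF i, of "Pair (0::real)"]
    by (simp add: prism_eq_def bbi chain_boundary_diff del: chain_map_of)
  ultimately obtain m' where m': "singular_chain (Suc (Suc q)) (cylinder ?S) m'"
      "chain_boundary (Suc (Suc q)) m' = ?z"
    using contractible_space_cycle_boundary[OF contractible_space_cylinder_simplex, of "Suc q"]
    by blast
  have "prism_eq (Suc q) m m' ?i"
    unfolding prism_eq_def prism_ext_simplex_id[OF m'(1)] by (simp add: m'(2) del: chain_map_of)
  then show thesis
    using m'(1) that by blast
qed

lemma prism_models:
  obtains m where "\<And>q. singular_chain (Suc q) (cylinder (simplex_space q)) (m q)"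
    "\<And>q. prism_eq q (m (q - 1)) (m q) (frag_of (simplex_id q))"
proof -
  \<comment> \<open>The invariant of the recursive choice sees only the current model, so its
    predecessor enters as an existential \<open>m0\<close>, while \<open>?Q\<close> ties consecutive
    models together. For \<open>q = 0\<close> there is no predecessor, and the equation is kept for
    every \<open>m0\<close>.\<close>
  let ?P = "\<lambda>q m. singular_chain (Suc q) (cylinder (simplex_space q)) m \<and>
    (q = 0 \<longrightarrow> (\<forall>m0. prism_eq q m0 m (frag_of (simplex_id q)))) \<and>
    (\<exists>m0. \<forall>d. singular_chain (Suc q) (simplex_space (Suc q)) d \<longrightarrow> prism_eq q m0 m (chain_boundary (Suc q) d))"
  let ?Q = "\<lambda>q m m'. prism_eq (Suc q) m m' (frag_of (simplex_id (Suc q)))"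
  have R: "prism_eq q m0 m (chain_boundary (Suc q) d)"
    if "0 < q \<Longrightarrow> singular_chain q (cylinder (simplex_space (q - 1))) m0"
      "singular_chain (Suc q) (cylinder (simplex_space q)) m"
      "prism_eq q m0 m (frag_of (simplex_id q))"
      "singular_chain (Suc q) (simplex_space (Suc q)) d" for q m0 m d
    using singular_chain_boundary[OF that(4)]
    by (intro prism_eq_from_model[OF that(1,2,3)]) auto
  have "\<exists>f. \<forall>q. ?P q (f q) \<and> ?Q q (f q) (f (Suc q))"
  proof (rule dependent_nat_choice[where P = ?P and Q = ?Q])
    obtain m where "singular_chain 1 (cylinder (simplex_space 0)) m"
      "\<And>m'. prism_eq 0 m' m (frag_of (simplex_id 0))"
      using prism_model_0 by blast
    then show "\<exists>m. ?P 0 m"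
      using R[of 0 m m] by (intro exI[of _ m]) auto
  next
    fix m q assume P: "?P q m"
    then obtain m0 where "\<And>d. singular_chain (Suc q) (simplex_space (Suc q)) d \<Longrightarrow>
        prism_eq q m0 m (chain_boundary (Suc q) d)"
      by blast
    then obtain m' where "singular_chain (Suc (Suc q)) (cylinder (simplex_space (Suc q))) m'"
      "prism_eq (Suc q) m m' (frag_of (simplex_id (Suc q)))"
      using prism_model_Suc[of q m m0] P by blast
    then show "\<exists>m'. ?P (Suc q) m' \<and> ?Q q m m'"
      using R[of "Suc q" m m'] P by (intro exI[of _ m'] conjI exI[of _ m]) auto
  qed
  then obtain f where f: "\<And>q. ?P q (f q)" "\<And>q. ?Q q (f q) (f (Suc q))"
    by blast
  have "prism_eq q (f (q - 1)) (f q) (frag_of (simplex_id q))" for q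
    using f(1)[of 0] f(2)[of "q - 1"] by (cases q) auto
  then show thesis
    using f(1) that by blast
qed

text \<open>\<open>D\<close> is the prism on the cylinder followed by the homotopy. Its additivity
  is part of the conclusion because \<open>glift\<close> relies on it when the formula passes to
  coefficients.\<close>

lemma chain_homotopic_maps:
  assumes "homotopic_with (\<lambda>_. True) X Y f g"
  obtains D where "\<And>q a b. D q (a - b) = D q a - D q b"
    "\<And>q c. singular_chain q X c \<Longrightarrow> singular_chain (Suc q) Y (D q c)"
    "\<And>q c. singular_chain q X c \<Longrightarrow>
      chain_boundary (Suc q) (D q c) + D (q - 1) (chain_boundary q c) = chain_map q g c - chain_map q f c"
proof -
  obtain h where h: "continuous_map (cylinder X) Y h" "\<And>x. h (0, x) = f x" "\<And>x. h (1, x) = g x"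
    using assms by (auto simp: homotopic_with_def)
  obtain m where m: "\<And>q. singular_chain (Suc q) (cylinder (simplex_space q)) (m q)"
    "\<And>q. prism_eq q (m (q - 1)) (m q) (frag_of (simplex_id q))"
    using prism_models by blast
  define D where "D q c = chain_map (Suc q) h (prism_ext q (m q) c)" for q c
  have ends: "chain_map q h (chain_map q (Pair 0) c) = chain_map q f c"
    "chain_map q h (chain_map q (Pair 1) c) = chain_map q g c" for q c
  proof -
    have "h \<circ> Pair 0 = f" "h \<circ> Pair 1 = g"
      using h by auto
    then show "chain_map q h (chain_map q (Pair 0) c) = chain_map q f c"
      "chain_map q h (chain_map q (Pair 1) c) = chain_map q g c"
      by (metis chain_map_compose comp_apply)+
  qed
  show thesis
  proof
    show "D q (a - b) = D q a - D q b" for q a b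
      by (simp add: D_def prism_ext_diff chain_map_diff)
    fix q c assume c: "singular_chain q X c"
    show "singular_chain (Suc q) Y (D q c)"
      unfolding D_def by (intro singular_chain_chain_map[OF _ h(1)] singular_chain_prism_ext m c)
    have mq: "0 < q \<Longrightarrow> singular_chain q (cylinder (simplex_space (q - 1))) (m (q - 1))"
      using m(1)[of "q - 1"] by simp
    have "chain_boundary (Suc q) (D q c) = chain_map q h (chain_boundary (Suc q) (prism_ext q (m q) c))"
      using chain_boundary_chain_map[OF singular_chain_prism_ext[OF m(1) c]] by (simp add: D_def)
    moreover have "D (q - 1) (chain_boundary q c) =
        chain_map q h (prism_ext (q - 1) (m (q - 1)) (chain_boundary q c))"
      by (cases q) (simp_all add: D_def chain_boundary_def)
    ultimately show "chain_boundary (Suc q) (D q c) + D (q - 1) (chain_boundary q c) =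
        chain_map q g c - chain_map q f c"
      using arg_cong[OF prism_eq_from_model[OF mq m c, unfolded prism_eq_def], of "chain_map q h"]
      by (simp add: chain_map_add chain_map_diff ends)
  qed
qed

lemma gchain_homotopy:
  assumes hom: "homotopic_with (\<lambda>_. True) X Y f g"
    and c: "c \<in> gchains k X" "gchain_boundary k c = 0"
  shows "gchain_map k g c - gchain_map k f c \<in> gboundaries k G Y"
proof -
  obtain D where D: "\<And>q a b. D q (a - b) = D q a - D q b"
    "\<And>q c. singular_chain q X c \<Longrightarrow> singular_chain (Suc q) Y (D q c)"
    "\<And>q c. singular_chain q X c \<Longrightarrow>
      chain_boundary (Suc q) (D q c) + D (q - 1) (chain_boundary q c) = chain_map q g c - chain_map q f c"
    using chain_homotopic_maps[OF hom] by blast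
  have "glift (\<lambda>x. chain_boundary (Suc k) (D k x) + D (k - 1) (chain_boundary k x)) c =
      glift (\<lambda>x. chain_map k g x - chain_map k f x) c"
    using c(1) by (rule glift_cong_gchains) (rule D(3), simp add: singular_chain_of)
  \<comment> \<open>Reading \<open>glift_glift\<close> from right to left separates the composites,
    so that \<open>D (k - 1)\<close> acts on the boundary of \<open>c\<close>, which is 0.\<close>
  then have "gchain_boundary (Suc k) (glift (D k) c) = gchain_map k g c - gchain_map k f c"
    using c(2)
    by (simp add: glift_plus glift_sub gchain_boundary_eq_glift gchain_map_eq_glift D(1)
        chain_boundary_diff flip: glift_glift)
  moreover have "glift (D k) c \<in> gchains (Suc k) Y"
    using c(1) by (rule glift_in_gchains) (simp add: D(2) singular_chain_of)
  ultimately show ?thesis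
    unfolding gboundaries_def by (metis image_eqI)
qed


section \<open>Vanishing homology and open covers\<close>

lemma gboundaries_iff: "c \<in> gboundaries k G X \<longleftrightarrow> (\<exists>e\<in>gchains (Suc k) X. gchain_boundary (Suc k) e = c)"
  by (auto simp: gboundaries_def)

lemma gboundaries_0 [simp]: "0 \<in> gboundaries k G X"
  unfolding gboundaries_iff by (rule bexI[of _ 0]) simp_all

lemma gboundaries_add: "c \<in> gboundaries k G X \<Longrightarrow> d \<in> gboundaries k G X \<Longrightarrow> c + d \<in> gboundaries k G X"
  unfolding gboundaries_iff by (metis gchain_boundary_add gchains_add)

lemma gboundaries_minus: "c \<in> gboundaries k G X \<Longrightarrow> - c \<in> gboundaries k G X"
  unfolding gboundaries_iff by (metis gchain_boundary_minus gchains_minus)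

lemma gboundaries_diff: "c \<in> gboundaries k G X \<Longrightarrow> d \<in> gboundaries k G X \<Longrightarrow> c - d \<in> gboundaries k G X"
  using gboundaries_add[of c k G X "- d"] gboundaries_minus[of d k G X] by simp

lemma gchain_map_gboundaries:
  assumes "continuous_map X Y f" "c \<in> gboundaries k G X"
  shows "gchain_map k f c \<in> gboundaries k G Y"
proof -
  obtain e where "e \<in> gchains (Suc k) X" "gchain_boundary (Suc k) e = c"
    using assms(2) by (auto simp: gboundaries_iff)
  then show ?thesis
    unfolding gboundaries_iff using assms(1)
    by (intro bexI[of _ "gchain_map (Suc k) f e"]) (auto simp: gchain_boundary_map gchain_map_in_gchains)
qed

text \<open>Vanishing in a single degree, expressed by cycles so that the geometry can proceed
  without quotient groups. Since homology is unreduced, for \<open>k = 0\<close> and nonzero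
  coefficients only the empty space qualifies.\<close>

definition gacyclic :: "nat \<Rightarrow> 'g::ab_group_add itself \<Rightarrow> 'a topology \<Rightarrow> bool"
  where "gacyclic k G X \<longleftrightarrow> (\<forall>c :: ('a, 'g) gchain. c \<in> gchains k X \<longrightarrow> gchain_boundary k c = 0 \<longrightarrow>
    c \<in> gboundaries k G X)"

lemma gacyclicD:
  fixes c :: "('a, 'g::ab_group_add) gchain" and G :: "'g itself"
  assumes "gacyclic k G X" "c \<in> gchains k X" "gchain_boundary k c = 0"
  obtains e where "e \<in> gchains (Suc k) X" "gchain_boundary (Suc k) e = c"
  using assms by (auto simp: gacyclic_def gboundaries_iff)

lemma gacyclic_empty:
  fixes X :: "'a topology" and G :: "'g::ab_group_add itself"
  assumes "topspace X = {}"
  shows "gacyclic k G X"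
proof -
  have "c = 0" if "c \<in> gchains k X" for c :: "('a, 'g) gchain"
  proof -
    have "Poly_Mapping.keys c = {}"
      using that singular_simplex_empty[OF assms] by (auto simp: gchains_def subset_iff simp del: keys_eq_empty)
    then show ?thesis
      by simp
  qed
  then show ?thesis
    by (metis gacyclic_def gboundaries_0)
qed

text \<open>\<open>c\<close> is homologous to its image under \<open>g \<circ> f\<close>, and that
  image bounds because \<open>f\<close> sends \<open>c\<close> to a bounding cycle of
  \<open>Y\<close>.\<close>

lemma gacyclic_dominated:
  assumes f: "continuous_map X Y f" and g: "continuous_map Y X g"
    and hom: "homotopic_with (\<lambda>_. True) X X (g \<circ> f) id" and Y: "gacyclic k G Y"
  shows "gacyclic k G X"
  unfolding gacyclic_def
proof (intro allI impI)
  fix c :: "('a, 'c) gchain" assume c: "c \<in> gchains k X" "gchain_boundary k c = 0"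
  have "gchain_map k f c \<in> gboundaries k G Y"
    using Y c f by (auto simp: gacyclic_def gchain_map_in_gchains gchain_boundary_map)
  then have "gchain_map k (g \<circ> f) c \<in> gboundaries k G X"
    unfolding gchain_map_compose by (rule gchain_map_gboundaries[OF g])
  moreover have "c - gchain_map k (g \<circ> f) c \<in> gboundaries k G X"
    using gchain_homotopy[OF hom c] by (simp add: gchain_map_ident[OF c(1), of id])
  ultimately show "c \<in> gboundaries k G X"
    using gboundaries_add by fastforce
qed

text \<open>A point has one simplex in each degree, and the boundary from degree \<open>p\<close> is
  an isomorphism for even \<open>p > 0\<close> and zero otherwise. For odd \<open>k\<close> every
  chain is the boundary of one in degree \<open>k + 1\<close>; for even \<open>k > 0\<close> only 0
  is a cycle.\<close>

lemma gacyclic_singleton: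
  assumes "topspace X = {a}" "0 < k"
  shows "gacyclic k G X"
  unfolding gacyclic_def
proof (intro allI impI)
  fix c :: "('a, 'b) gchain" assume c: "c \<in> gchains k X" "gchain_boundary k c = 0"
  define s where "s p = restrict (\<lambda>x :: nat \<Rightarrow> real. a) (standard_simplex p)" for p
  have s: "singular_simplex p X t \<longleftrightarrow> t = s p" for p t
    using singular_simplex_singleton[OF assms(1)] by (simp add: s_def)
  define g where "g = Poly_Mapping.lookup c (s k)"
  have "Poly_Mapping.keys c \<subseteq> {s k}"
    using c(1) by (auto simp: gchains_def s)
  then have c_eq: "c = Poly_Mapping.single (s k) g"
    by (intro poly_mapping_eqI) (auto simp: g_def lookup_single when_def in_keys_iff subset_iff)
  have bd: "chain_boundary p (frag_of (s p)) = (if p = 0 \<or> odd p then 0 else frag_of (s (p - 1)))" for p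
    using chain_boundary_of_singleton[OF assms(1), of p "frag_of (s p)"]
    by (simp add: singular_chain_of s s_def)
  show "c \<in> gboundaries k G X"
  proof (cases "odd k")
    case True
    then have "gchain_boundary (Suc k) (Poly_Mapping.single (s (Suc k)) g) = c"
      by (simp add: gchain_boundary_eq_glift glift_def bd c_eq)
    moreover have "Poly_Mapping.single (s (Suc k)) g \<in> gchains (Suc k) X"
      by (auto simp: gchains_def s split: if_splits)
    ultimately show ?thesis
      by (auto simp: gboundaries_iff)
  next
    case False
    then have "Poly_Mapping.single (s (k - 1)) g = 0"
      using c(2) assms(2) by (simp add: gchain_boundary_eq_glift glift_def bd c_eq)
    then have "g = 0"
      by (metis lookup_single_eq lookup_zero)
    then show ?thesis
      by (simp add: c_eq)
  qed
qed

lemma gacyclic_contractible: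
  assumes "contractible_space X" "0 < k"
  shows "gacyclic k G X"
proof (cases "topspace X = {}")
  case False
  obtain a where hom: "homotopic_with (\<lambda>_. True) X X id (\<lambda>_. a)"
    using assms(1) by (auto simp: contractible_space_def)
  then have a: "a \<in> topspace X"
    using homotopic_with_imp_continuous_maps[OF hom] False by (auto simp: continuous_map_def)
  have "gacyclic k G (subtopology X {a})"
    using a assms(2) by (intro gacyclic_singleton[of _ a]) (auto simp: topspace_subtopology)
  then show ?thesis
    using a homotopic_with_symD[OF hom]
    by (intro gacyclic_dominated[of X "subtopology X {a}" "\<lambda>_. a" id])
      (auto simp: continuous_map_in_subtopology continuous_map_from_subtopology o_def)
qed (rule gacyclic_empty)

section \<open>Small chains and the Mayer-Vietoris argument\<close>

lemma gchain_split:
  fixes c :: "'a \<Rightarrow>\<^sub>0 'g::ab_group_add"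
  assumes "Poly_Mapping.keys c \<subseteq> S \<union> T"
  obtains d e where "Poly_Mapping.keys d \<subseteq> S" "Poly_Mapping.keys e \<subseteq> T" "c = d + e"
proof
  let ?d = "gext (\<lambda>s. if s \<in> S then frag_of s else 0) c"
  let ?e = "gext (\<lambda>s. if s \<in> S then 0 else frag_of s) c"
  show "Poly_Mapping.keys ?d \<subseteq> S" "Poly_Mapping.keys ?e \<subseteq> T"
    using assms by (auto intro!: order_trans[OF keys_gext] split: if_splits)
  have "c = gext frag_of c"
    by simp
  also have "\<dots> = ?d + ?e"
    unfolding gext_def sum.distrib[symmetric] by (intro sum.cong) auto
  finally show "c = ?d + ?e" .
qed

text \<open>Iterated subdivision is chain homotopic to the identity by an additive operator, so
  \<open>glift\<close> transfers the homotopy. Smallness is a matter of supports and is therefore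
  decided on each simplex of \<open>c\<close> separately.\<close>

lemma gchain_small_subdivision:
  fixes c :: "('a, 'g::ab_group_add) gchain"
  assumes UV: "openin X U" "openin X V" "topspace X \<subseteq> U \<union> V"
    and c: "c \<in> gchains k X" "gchain_boundary k c = 0"
  obtains c' where "c' \<in> gchains k X" "c' - c \<in> gboundaries k G X"
    "\<And>s. s \<in> Poly_Mapping.keys c' \<Longrightarrow> s ` standard_simplex k \<subseteq> U \<or> s ` standard_simplex k \<subseteq> V"
proof -
  have "\<exists>n. \<forall>m\<ge>n. \<forall>t\<in>Poly_Mapping.keys ((singular_subdivision k ^^ m) (frag_of s)).
      t ` standard_simplex k \<subseteq> U \<or> t ` standard_simplex k \<subseteq> V" if "s \<in> Poly_Mapping.keys c" for s
  proof -
    have "singular_chain k X (frag_of s)"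
      using that c(1) by (auto simp: gchains_def singular_chain_of)
    then obtain n where "\<And>m f. n \<le> m \<Longrightarrow> f \<in> Poly_Mapping.keys ((singular_subdivision k ^^ m) (frag_of s)) \<Longrightarrow>
        \<exists>W\<in>{U, V}. f \<in> standard_simplex k \<rightarrow> W"
      using sufficient_iterated_singular_subdivision_exists[of "{U, V}" X k "frag_of s"] UV by auto
    then show ?thesis
      by (intro exI[of _ n]) (auto simp: image_subset_iff_funcset)
  qed
  then obtain n where n: "\<And>s m t. s \<in> Poly_Mapping.keys c \<Longrightarrow> n s \<le> m \<Longrightarrow>
      t \<in> Poly_Mapping.keys ((singular_subdivision k ^^ m) (frag_of s)) \<Longrightarrow>
      t ` standard_simplex k \<subseteq> U \<or> t ` standard_simplex k \<subseteq> V"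
    by metis
  \<comment> \<open>The required number of subdivisions depends on the simplex; the sum over the
    finite support dominates all of them.\<close>
  define m where "m = (\<Sum>s\<in>Poly_Mapping.keys c. n s)"
  have nm: "n s \<le> m" if "s \<in> Poly_Mapping.keys c" for s
    unfolding m_def using that by (intro member_le_sum) auto
  obtain h where h: "\<And>p. h p 0 = (0 :: 'a chain)"
    "\<And>p c1 c2. h p (c1 - c2) = h p c1 - h p c2"
    "\<And>p X c. singular_chain p X c \<Longrightarrow> singular_chain (Suc p) X (h p c)"
    "\<And>p X c. singular_chain p X c \<Longrightarrow>
      chain_boundary (Suc p) (h p c) + h (p - Suc 0) (chain_boundary p c) = (singular_subdivision p ^^ m) c - c"
    using chain_homotopic_iterated_singular_subdivision[where n = m] by blast
  define sd where "sd = glift (singular_subdivision k ^^ m) c"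
  have "glift (\<lambda>x. chain_boundary (Suc k) (h k x) + h (k - Suc 0) (chain_boundary k x)) c =
      glift (\<lambda>x. (singular_subdivision k ^^ m) x - x) c"
    using c(1) by (rule glift_cong_gchains) (rule h(4)[of k X], simp add: singular_chain_of)
  then have bd: "gchain_boundary (Suc k) (glift (h k) c) = sd - c"
    using c(2)
    by (simp add: sd_def glift_plus glift_sub gchain_boundary_eq_glift h(2) glift_id
        chain_boundary_diff flip: glift_glift)
  have hc: "glift (h k) c \<in> gchains (Suc k) X"
    using c(1) by (rule glift_in_gchains) (simp add: h(3) singular_chain_of)
  have "gchain_boundary (Suc k) (glift (h k) c) \<in> gchains k X"
    using gchain_boundary_in_gchains[OF hc] by simp
  then have "sd \<in> gchains k X"
    using gchains_add[OF _ c(1), of "sd - c"] bd by simp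
  moreover have "sd - c \<in> gboundaries k G X"
    using hc bd by (auto simp: gboundaries_iff)
  moreover have "t ` standard_simplex k \<subseteq> U \<or> t ` standard_simplex k \<subseteq> V"
    if "t \<in> Poly_Mapping.keys sd" for t
    using that n nm keys_glift[of "singular_subdivision k ^^ m" c] unfolding sd_def by blast
  ultimately show thesis
    using that by blast
qed

lemma gchains_subtopology:
  "c \<in> gchains p (subtopology X S) \<longleftrightarrow>
    c \<in> gchains p X \<and> (\<forall>s\<in>Poly_Mapping.keys c. s ` standard_simplex p \<subseteq> S)"
  by (fastforce simp: gchains_def singular_simplex_subtopology subset_eq)

lemma gchains_subtopology_mono: "c \<in> gchains p (subtopology X S) \<Longrightarrow> c \<in> gchains p X"
  by (simp add: gchains_subtopology)

text \<open>Split a small cycle as \<open>a + b\<close> with \<open>a\<close> in \<open>U\<close>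
  and \<open>b\<close> in \<open>V\<close>. The common boundary is filled by \<open>e\<close> inside
  the intersection, and \<open>a - e\<close> and \<open>b + e\<close> are cycles in \<open>U\<close>
  and \<open>V\<close>, which bound there.\<close>

lemma gacyclic_Mayer_Vietoris:
  assumes UV: "openin X U" "openin X V" "topspace X \<subseteq> U \<union> V" and "0 < k"
    and U: "gacyclic k G (subtopology X U)" and V: "gacyclic k G (subtopology X V)"
    and I: "gacyclic (k - 1) G (subtopology X (U \<inter> V))"
  shows "gacyclic k G X"
  unfolding gacyclic_def
proof (intro allI impI)
  fix c :: "('a, 'b) gchain" assume c: "c \<in> gchains k X" "gchain_boundary k c = 0"
  obtain c' where c': "c' \<in> gchains k X" "c' - c \<in> gboundaries k G X"
    "\<And>s. s \<in> Poly_Mapping.keys c' \<Longrightarrow> s ` standard_simplex k \<subseteq> U \<or> s ` standard_simplex k \<subseteq> V"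
    using gchain_small_subdivision[OF UV c] by metis
  obtain e where "e \<in> gchains (Suc k) X" "gchain_boundary (Suc k) e = c' - c"
    using c'(2) by (auto simp: gboundaries_iff)
  then have "gchain_boundary k (c' - c) = 0"
    using gchain_boundary_boundary[of e "Suc k" X] by simp
  then have bc': "gchain_boundary k c' = 0"
    using c(2) by (simp add: gchain_boundary_diff)
  have keys: "Poly_Mapping.keys c' \<subseteq>
      singular_simplex_set k (subtopology X U) \<union> singular_simplex_set k (subtopology X V)"
  proof
    fix s assume "s \<in> Poly_Mapping.keys c'"
    then show "s \<in> singular_simplex_set k (subtopology X U) \<union> singular_simplex_set k (subtopology X V)"
      using c'(1) c'(3)[of s] by (auto simp: gchains_def singular_simplex_subtopology)
  qed
  obtain a b where "Poly_Mapping.keys a \<subseteq> singular_simplex_set k (subtopology X U)"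
    "Poly_Mapping.keys b \<subseteq> singular_simplex_set k (subtopology X V)" and c'_eq: "c' = a + b"
    by (rule gchain_split[OF keys])
  then have a: "a \<in> gchains k (subtopology X U)" and b: "b \<in> gchains k (subtopology X V)"
    by (auto simp: gchains_def)
  have ab: "gchain_boundary k a = - gchain_boundary k b"
    using bc' by (simp add: c'_eq gchain_boundary_add add_eq_0_iff2)
  \<comment> \<open>The boundary of \<open>a\<close> lies in \<open>U\<close>, and in
    \<open>V\<close> as well because it is minus the boundary of \<open>b\<close>.\<close>
  have "gchain_boundary k a \<in> gchains (k - 1) (subtopology X (U \<inter> V))"
    using gchain_boundary_in_gchains[OF a] gchain_boundary_in_gchains[OF b]
    unfolding gchains_subtopology ab by auto
  moreover have "gchain_boundary (k - 1) (gchain_boundary k a) = 0"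
    using gchain_boundary_boundary[OF a] by simp
  ultimately obtain e where "e \<in> gchains (Suc (k - 1)) (subtopology X (U \<inter> V))"
    "gchain_boundary (Suc (k - 1)) e = gchain_boundary k a"
    using gacyclicD[OF I] by blast
  then have e: "e \<in> gchains k (subtopology X (U \<inter> V))" "gchain_boundary k e = gchain_boundary k a"
    using \<open>0 < k\<close> by auto
  have eU: "e \<in> gchains k (subtopology X U)" and eV: "e \<in> gchains k (subtopology X V)"
    using e(1) by (auto simp: gchains_subtopology)
  obtain a' where a': "a' \<in> gchains (Suc k) (subtopology X U)" "gchain_boundary (Suc k) a' = a - e"
    using gacyclicD[OF U gchains_diff[OF a eU]] e(2) by (auto simp: gchain_boundary_diff)
  obtain b' where b': "b' \<in> gchains (Suc k) (subtopology X V)" "gchain_boundary (Suc k) b' = b + e"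
    using gacyclicD[OF V gchains_add[OF b eV]] e(2) ab by (auto simp: gchain_boundary_add)
  have "c' \<in> gboundaries k G X"
    unfolding gboundaries_iff
    using gchains_subtopology_mono[OF a'(1)] gchains_subtopology_mono[OF b'(1)] a'(2) b'(2)
    by (intro bexI[of _ "a' + b'"]) (auto simp: gchain_boundary_add c'_eq gchains_add)
  then show "c \<in> gboundaries k G X"
    using gboundaries_diff[OF _ c'(2), of c'] by simp
qed


section \<open>Homology of polyhedra above the dimension\<close>

definition realization :: "'v set set \<Rightarrow> ('v \<Rightarrow> real) set"
  where "realization K = (\<Union>\<sigma>\<in>K. closed_simplex \<sigma>)"

lemma closed_simplex_convex:
  assumes "\<alpha> \<in> closed_simplex \<sigma>" "\<beta> \<in> closed_simplex \<sigma>" "0 \<le> t" "t \<le> 1"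
  shows "(\<lambda>v. (1 - t) * \<alpha> v + t * \<beta> v) \<in> closed_simplex \<sigma>"
  using assms by (auto simp: closed_simplex_def sum.distrib simp flip: sum_distrib_left)

text \<open>In this form \<open>\<sigma>\<close> matters only as a set containing the support, so
  passing to a larger simplex or to the smallest one is immediate.\<close>

lemma closed_simplex_support:
  assumes "finite \<sigma>"
  shows "\<alpha> \<in> closed_simplex \<sigma> \<longleftrightarrow>
    (\<forall>v. 0 \<le> \<alpha> v) \<and> {v. \<alpha> v \<noteq> 0} \<subseteq> \<sigma> \<and> (\<Sum>v | \<alpha> v \<noteq> 0. \<alpha> v) = 1"
proof -
  have sum: "sum \<alpha> \<sigma> = (\<Sum>v | \<alpha> v \<noteq> 0. \<alpha> v)" if "{v. \<alpha> v \<noteq> 0} \<subseteq> \<sigma>"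
    using that assms by (intro sum.mono_neutral_right) auto
  have "(\<forall>v. v \<notin> \<sigma> \<longrightarrow> \<alpha> v = 0) \<longleftrightarrow> {v. \<alpha> v \<noteq> 0} \<subseteq> \<sigma>"
    by blast
  then show ?thesis
    unfolding closed_simplex_def using sum by (simp cong: conj_cong)
qed

text \<open>The support is a face of every simplex that carries the point, and it is nonempty
  because the coordinates add up to 1.\<close>

lemma support_in_complex:
  assumes K: "abstract_complex K" and \<alpha>: "\<alpha> \<in> realization K"
  shows "{v. \<alpha> v \<noteq> 0} \<in> K" "\<alpha> \<in> closed_simplex {v. \<alpha> v \<noteq> 0}"
proof -
  obtain \<sigma> where \<sigma>: "\<sigma> \<in> K" "\<alpha> \<in> closed_simplex \<sigma>"
    using \<alpha> by (auto simp: realization_def)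
  then have "finite \<sigma>"
    using K by (auto simp: abstract_complex_def)
  then have *: "\<forall>v. 0 \<le> \<alpha> v" "{v. \<alpha> v \<noteq> 0} \<subseteq> \<sigma>" "(\<Sum>v | \<alpha> v \<noteq> 0. \<alpha> v) = 1"
    using \<sigma>(2) by (auto simp: closed_simplex_support)
  then have "{v. \<alpha> v \<noteq> 0} \<noteq> {}"
    by (metis sum.empty zero_neq_one)
  then show "{v. \<alpha> v \<noteq> 0} \<in> K"
    using K \<sigma>(1) *(2) unfolding abstract_complex_def by blast
  show "\<alpha> \<in> closed_simplex {v. \<alpha> v \<noteq> 0}"
    using * finite_subset[OF *(2) \<open>finite \<sigma>\<close>] by (simp add: closed_simplex_support)
qed

lemma vertex_in_closed_simplex:
  assumes "finite \<sigma>" "v \<in> \<sigma>"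
  shows "(\<lambda>w. if w = v then 1 else 0) \<in> closed_simplex \<sigma>"
  using assms by (auto simp: closed_simplex_def)

lemma closed_simplex_mono:
  "\<sigma> \<subseteq> \<tau> \<Longrightarrow> finite \<tau> \<Longrightarrow> closed_simplex \<sigma> \<subseteq> closed_simplex \<tau>"
  using finite_subset[of \<sigma> \<tau>] order_trans[of _ \<sigma> \<tau>] by (simp add: closed_simplex_support subset_iff)

text \<open>Radial projection from \<open>v\<close> to the opposite face; meaningless where \<open>\<alpha> v = 1\<close>.\<close>

definition vertex_proj :: "'v \<Rightarrow> ('v \<Rightarrow> real) \<Rightarrow> ('v \<Rightarrow> real)"
  where "vertex_proj v \<alpha> = (\<lambda>w. if w = v then 0 else \<alpha> w / (1 - \<alpha> v))"

text \<open>Without \<open>v\<close> the coordinates add up to \<open>1 - \<alpha> v\<close>, and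
  the divisor restores the total 1.\<close>

lemma vertex_proj_closed_simplex:
  assumes "finite \<sigma>" "\<alpha> \<in> closed_simplex \<sigma>" "\<alpha> v < 1"
  shows "vertex_proj v \<alpha> \<in> closed_simplex (\<sigma> - {v})"
proof -
  have 1: "sum \<alpha> \<sigma> = 1"
    using assms(2) by (simp add: closed_simplex_def)
  have "(\<Sum>w\<in>\<sigma> - {v}. vertex_proj v \<alpha> w) = (\<Sum>w\<in>\<sigma> - {v}. \<alpha> w) / (1 - \<alpha> v)"
    unfolding sum_divide_distrib by (intro sum.cong) (auto simp: vertex_proj_def)
  also have "(\<Sum>w\<in>\<sigma> - {v}. \<alpha> w) = 1 - \<alpha> v"
  proof (cases "v \<in> \<sigma>")
    case True
    then show ?thesis
      using 1 assms(1) by (simp add: sum_diff1)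
  next
    case False
    then show ?thesis
      using 1 assms(2) by (simp add: closed_simplex_def)
  qed
  finally show ?thesis
    using assms(2,3) by (auto simp: closed_simplex_def vertex_proj_def)
qed

lemma continuous_map_vertex_proj:
  "continuous_map (subtopology (powertop_real UNIV) {\<alpha>. \<alpha> v < 1}) (powertop_real UNIV) (vertex_proj v)"
proof -
  let ?X = "subtopology (powertop_real UNIV) {\<alpha>. \<alpha> v < 1}"
  have "continuous_map ?X euclideanreal (\<lambda>\<alpha>. \<alpha> w / (1 - \<alpha> v))" for w
    by (intro continuous_map_real_divide continuous_intros continuous_map_from_subtopology
        continuous_map_product_projection) (auto simp: topspace_subtopology)
  then show ?thesis
    unfolding continuous_map_componentwise_UNIV vertex_proj_def
    by (auto intro: continuous_intros)
qed

text \<open>\<open>W\<close> is any finite set containing the vertices, so a complex that avoids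
  \<open>v\<close> falls under the induction hypothesis at once. \<open>K\<close>, \<open>n\<close>
  and \<open>k\<close> vary because the link is used with \<open>n - 1\<close> and
  \<open>k - 1\<close>, which preserves \<open>n \<le> k\<close>.\<close>

lemma gacyclic_finite_complex:
  assumes "finite W" "\<Union>K \<subseteq> W" "abstract_complex K" "\<And>\<sigma>. \<sigma> \<in> K \<Longrightarrow> card \<sigma> \<le> n" "n \<le> k"
  shows "gacyclic k G (subtopology (powertop_real UNIV) (realization K))"
  using assms
proof (induction W arbitrary: K n k rule: finite_induct)
  case empty
  then have "K = {}"
    by (auto simp: abstract_complex_def)
  then show ?case
    by (intro gacyclic_empty) (simp add: realization_def)
next
  case (insert v W)
  let ?T = "powertop_real UNIV :: ('a \<Rightarrow> real) topology"
  have K: "\<And>\<sigma>. \<sigma> \<in> K \<Longrightarrow> finite \<sigma>" "\<And>\<sigma>. \<sigma> \<in> K \<Longrightarrow> \<sigma> \<noteq> {}"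
    "\<And>\<sigma> \<tau>. \<sigma> \<in> K \<Longrightarrow> \<tau> \<subseteq> \<sigma> \<Longrightarrow> \<tau> \<noteq> {} \<Longrightarrow> \<tau> \<in> K"
    using insert.prems(2) unfolding abstract_complex_def by blast+
  show ?case
  proof (cases "{v} \<in> K")
    case False
    then have "v \<notin> \<Union>K"
      using K(3) by blast
    then have "\<Union>K \<subseteq> W"
      using insert.prems(1) by blast
    then show ?thesis
      by (rule insert.IH) (use insert.prems in simp_all)
  next
    case True
    then have "1 \<le> n"
      using insert.prems(3)[of "{v}"] by simp
    \<comment> \<open>\<open>D\<close> is the deletion of \<open>v\<close> and \<open>L\<close> its
      link; \<open>U\<close> is the complement of the point \<open>v\<close> and \<open>V\<close>
      its open star.\<close>
    define D where "D = {\<sigma> \<in> K. v \<notin> \<sigma>}"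
    define L where "L = {\<sigma>. \<sigma> \<noteq> {} \<and> v \<notin> \<sigma> \<and> insert v \<sigma> \<in> K}"
    define R where "R = realization K"
    define U where "U = {\<alpha> \<in> R. \<alpha> v < 1}"
    define V where "V = {\<alpha> \<in> R. 0 < \<alpha> v}"
    have LK: "L \<subseteq> K"
      unfolding L_def using K(3) by blast
    have "abstract_complex D"
      using K unfolding abstract_complex_def D_def by blast
    moreover have "\<Union>D \<subseteq> W"
      using insert.prems(1) by (auto simp: D_def)
    ultimately have gD: "gacyclic k G (subtopology ?T (realization D))"
      using insert.prems(3,4) by (intro insert.IH[of D n k]) (auto simp: D_def)
    have "abstract_complex L"
    proof -
      have "\<tau> \<in> L" if "\<sigma> \<in> L" "\<tau> \<subseteq> \<sigma>" "\<tau> \<noteq> {}" for \<sigma> \<tau>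
      proof -
        have "insert v \<sigma> \<in> K" "v \<notin> \<sigma>"
          using that(1) by (auto simp: L_def)
        then have "insert v \<tau> \<in> K" "v \<notin> \<tau>"
          using that(2) K(3)[of "insert v \<sigma>" "insert v \<tau>"] by auto
        then show ?thesis
          using that(3) by (simp add: L_def)
      qed
      moreover have "finite \<sigma> \<and> \<sigma> \<noteq> {}" if "\<sigma> \<in> L" for \<sigma>
        using that LK K(1,2) by blast
      ultimately show ?thesis
        unfolding abstract_complex_def by blast
    qed
    moreover have "\<Union>L \<subseteq> W"
      using insert.prems(1) LK by (auto simp: L_def)
    moreover have "card \<sigma> \<le> n - 1" if "\<sigma> \<in> L" for \<sigma>
      using that insert.prems(3)[of "insert v \<sigma>"] K(1)[of "insert v \<sigma>"] by (auto simp: L_def)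
    ultimately have gL: "gacyclic (k - 1) G (subtopology ?T (realization L))"
      using insert.prems(4) by (intro insert.IH[of L "n - 1" "k - 1"]) auto
    have supp: "{w. \<alpha> w \<noteq> 0} \<in> K" "\<alpha> \<in> closed_simplex {w. \<alpha> w \<noteq> 0}" if "\<alpha> \<in> R" for \<alpha>
      using support_in_complex[OF insert.prems(2)] that by (auto simp: R_def)
    have in_R: "\<alpha> \<in> R" if "\<alpha> \<in> closed_simplex \<sigma>" "\<sigma> \<in> K" for \<alpha> \<sigma>
      using that by (auto simp: R_def realization_def)
    have proj: "vertex_proj v \<alpha> \<in> closed_simplex ({w. \<alpha> w \<noteq> 0} - {v})" if "\<alpha> \<in> U" for \<alpha>
      using that supp by (intro vertex_proj_closed_simplex) (auto simp: U_def K(1))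
    have ne: "{w. \<alpha> w \<noteq> 0} - {v} \<noteq> {}" if "\<alpha> \<in> U" for \<alpha>
    proof
      assume "{w. \<alpha> w \<noteq> 0} - {v} = {}"
      \<comment> \<open>\<open>closed_simplex {}\<close> has no points, because an empty sum is not
        1.\<close>
      then have "vertex_proj v \<alpha> \<in> closed_simplex {}"
        using proj[OF that] by (simp only:)
      then show False
        by (simp add: closed_simplex_def)
    qed
    have D: "{w. \<alpha> w \<noteq> 0} - {v} \<in> D" if "\<alpha> \<in> U" for \<alpha>
      using that ne[OF that] K(3)[OF supp(1), of \<alpha>] by (auto simp: D_def U_def)
    have L: "{w. \<alpha> w \<noteq> 0} - {v} \<in> L" if "\<alpha> \<in> U \<inter> V" for \<alpha>
    proof -
      have "insert v ({w. \<alpha> w \<noteq> 0} - {v}) = {w. \<alpha> w \<noteq> 0}"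
        using that by (auto simp: V_def)
      then show ?thesis
        using that ne[of \<alpha>] supp(1)[of \<alpha>] by (simp add: L_def U_def)
    qed
    have proj': "vertex_proj v \<alpha> \<in> closed_simplex {w. \<alpha> w \<noteq> 0}" if "\<alpha> \<in> U" for \<alpha>
      using proj[OF that] closed_simplex_mono[of "{w. \<alpha> w \<noteq> 0} - {v}" "{w. \<alpha> w \<noteq> 0}"]
        K(1)[OF supp(1)] that by (auto simp: U_def)
    have proj_v: "vertex_proj v \<alpha> v = 0" for \<alpha>
      by (simp add: vertex_proj_def)
    define e where "e = (\<lambda>w. if w = v then 1 else 0 :: real)"
    have e: "e \<in> closed_simplex {w. \<alpha> w \<noteq> 0}" if "\<alpha> \<in> V" for \<alpha>
      unfolding e_def using that K(1)[OF supp(1)] by (intro vertex_in_closed_simplex) (auto simp: V_def)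
    have cont_proj: "continuous_map (subtopology ?T A) ?T (vertex_proj v)" if "A \<subseteq> U" for A
      using continuous_map_from_subtopology_mono[OF continuous_map_vertex_proj, of A v] that
      by (auto simp: U_def)
    have gU: "gacyclic k G (subtopology ?T U)"
    proof (rule gacyclic_dominated[OF _ _ _ gD])
      show "continuous_map (subtopology ?T U) (subtopology ?T (realization D)) (vertex_proj v)"
        using cont_proj[of U] proj D by (auto simp: continuous_map_in_subtopology realization_def)
      have "realization D \<subseteq> U"
      proof
        fix \<alpha> assume "\<alpha> \<in> realization D"
        then obtain \<sigma> where "\<sigma> \<in> D" "\<alpha> \<in> closed_simplex \<sigma>"
          by (auto simp: realization_def)
        then show "\<alpha> \<in> U"
          using in_R[of \<alpha> \<sigma>] by (auto simp: D_def U_def closed_simplex_def)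
      qed
      then show "continuous_map (subtopology ?T (realization D)) (subtopology ?T U) id"
        by (auto simp: continuous_map_in_subtopology continuous_map_from_subtopology)
      show "homotopic_with (\<lambda>_. True) (subtopology ?T U) (subtopology ?T U) (id \<circ> vertex_proj v) id"
      proof (rule homotopic_with_powertop_linear)
        fix \<alpha> t assume "\<alpha> \<in> topspace (subtopology ?T U)" and t: "0 \<le> t" "t \<le> (1::real)"
        then have \<alpha>: "\<alpha> \<in> U" "\<alpha> \<in> R" "\<alpha> v < 1"
          by (auto simp: U_def)
        \<comment> \<open>The projection does not leave the closed simplex spanned by the support of
          \<open>\<alpha>\<close>, so the whole segment stays in \<open>R\<close>; its
          \<open>v\<close>-coordinate is \<open>t * \<alpha> v\<close>.\<close>
        have "(\<lambda>w. (1 - t) * vertex_proj v \<alpha> w + t * \<alpha> w) \<in> closed_simplex {w. \<alpha> w \<noteq> 0}"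
          using \<alpha> supp proj' t by (intro closed_simplex_convex) auto
        moreover have "t * \<alpha> v < 1"
          using t \<alpha>(3) supp(2)[OF \<alpha>(2)] mult_left_le_one_le[of "\<alpha> v" t] by (auto simp: closed_simplex_def)
        ultimately show "(\<lambda>w. (1 - t) * (id \<circ> vertex_proj v) \<alpha> w + t * id \<alpha> w) \<in> U"
          using in_R supp(1)[OF \<alpha>(2)] by (auto simp: U_def proj_v)
      qed (use cont_proj[of U] in \<open>auto simp: continuous_map_from_subtopology\<close>)
    qed
    have gV: "gacyclic k G (subtopology ?T V)"
    proof (rule gacyclic_contractible)
      \<comment> \<open>The open star is star-shaped about the vertex \<open>e\<close>: moving
        towards \<open>e\<close> never decreases the \<open>v\<close>-coordinate.\<close>
      have "homotopic_with (\<lambda>_. True) (subtopology ?T V) (subtopology ?T V) id (\<lambda>_. e)"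
      proof (rule homotopic_with_powertop_linear)
        fix \<alpha> t assume "\<alpha> \<in> topspace (subtopology ?T V)" and t: "0 \<le> t" "t \<le> (1::real)"
        then have \<alpha>: "\<alpha> \<in> V" "\<alpha> \<in> R" "0 < \<alpha> v"
          by (auto simp: V_def)
        have "(\<lambda>w. (1 - t) * \<alpha> w + t * e w) \<in> closed_simplex {w. \<alpha> w \<noteq> 0}"
          using \<alpha> supp e t by (intro closed_simplex_convex) auto
        moreover have "0 < (1 - t) * \<alpha> v + t"
          using t \<alpha>(3) by (cases "t = 1") (auto intro: add_pos_nonneg)
        ultimately show "(\<lambda>w. (1 - t) * id \<alpha> w + t * e w) \<in> V"
          using in_R supp(1)[OF \<alpha>(2)] by (auto simp: V_def e_def)
      qed (auto simp: continuous_map_from_subtopology)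
      then show "contractible_space (subtopology ?T V)"
        by (auto simp: contractible_space_def)
      show "0 < k"
        using \<open>1 \<le> n\<close> insert.prems(4) by simp
    qed
    have gUV: "gacyclic (k - 1) G (subtopology ?T (U \<inter> V))"
    proof (rule gacyclic_dominated[OF _ _ _ gL])
      \<comment> \<open>The link is placed halfway between itself and the vertex, where the
        \<open>v\<close>-coordinate is 1/2. The unreduced \<open>1 - 1/2\<close> makes the formula
        match \<open>closed_simplex_convex\<close>.\<close>
      let ?j = "\<lambda>\<beta> w. (1 - 1/2) * \<beta> w + 1/2 * e w"
      show "continuous_map (subtopology ?T (U \<inter> V)) (subtopology ?T (realization L)) (vertex_proj v)"
        using cont_proj[of "U \<inter> V"] proj L by (auto simp: continuous_map_in_subtopology realization_def)
      have cont_j: "continuous_map (subtopology ?T A) ?T ?j" for A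
        unfolding continuous_map_componentwise_UNIV
        by (intro allI continuous_intros continuous_map_from_subtopology continuous_map_product_projection)
          auto
      have "?j \<beta> \<in> U \<inter> V" if \<beta>: "\<beta> \<in> realization L" for \<beta>
      proof -
        obtain \<sigma> where \<sigma>: "\<sigma> \<in> L" "\<beta> \<in> closed_simplex \<sigma>"
          using \<beta> by (auto simp: realization_def)
        then have fin: "finite (insert v \<sigma>)" and vK: "insert v \<sigma> \<in> K"
          using K(1)[of "insert v \<sigma>"] by (auto simp: L_def)
        have "?j \<beta> \<in> closed_simplex (insert v \<sigma>)"
        proof (rule closed_simplex_convex)
          show "\<beta> \<in> closed_simplex (insert v \<sigma>)"
            using \<sigma>(2) closed_simplex_mono[OF _ fin, of \<sigma>] by blast
          show "e \<in> closed_simplex (insert v \<sigma>)"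
            unfolding e_def using fin by (intro vertex_in_closed_simplex) auto
        qed auto
        moreover have "\<beta> v = 0"
          using \<sigma> by (auto simp: L_def closed_simplex_def)
        ultimately show ?thesis
          using in_R vK by (auto simp: U_def V_def e_def)
      qed
      then show "continuous_map (subtopology ?T (realization L)) (subtopology ?T (U \<inter> V)) ?j"
        using cont_j by (auto simp: continuous_map_in_subtopology)
      show "homotopic_with (\<lambda>_. True) (subtopology ?T (U \<inter> V)) (subtopology ?T (U \<inter> V))
          (?j \<circ> vertex_proj v) id"
      proof (rule homotopic_with_powertop_linear)
        fix \<alpha> t assume "\<alpha> \<in> topspace (subtopology ?T (U \<inter> V))" and t: "0 \<le> t" "t \<le> (1::real)"
        then have \<alpha>: "\<alpha> \<in> U" "\<alpha> \<in> V" "\<alpha> \<in> R" "0 < \<alpha> v" "\<alpha> v < 1"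
          by (auto simp: U_def V_def)
        have "?j (vertex_proj v \<alpha>) \<in> closed_simplex {w. \<alpha> w \<noteq> 0}"
          by (intro closed_simplex_convex proj' e \<alpha>) auto
        then have "(\<lambda>w. (1 - t) * ?j (vertex_proj v \<alpha>) w + t * \<alpha> w) \<in> closed_simplex {w. \<alpha> w \<noteq> 0}"
          by (rule closed_simplex_convex[OF _ supp(2)[OF \<alpha>(3)] t])
        then have "(\<lambda>w. (1 - t) * ?j (vertex_proj v \<alpha>) w + t * \<alpha> w) \<in> R"
          using in_R supp(1)[OF \<alpha>(3)] by blast
        \<comment> \<open>The \<open>v\<close>-coordinate runs linearly from 1/2 to
          \<open>\<alpha> v\<close>, both strictly between 0 and 1, so it avoids both ends
          throughout.\<close>
        moreover have "0 < (1 - t) * (1/2) + t * \<alpha> v"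
          using t \<alpha>(4) by (cases "t = 1") (auto intro: add_pos_nonneg)
        moreover have "(1 - t) * (1/2) + t * \<alpha> v < 1"
        proof -
          have "t * \<alpha> v \<le> t"
            using t \<alpha>(5) by (intro mult_left_le) auto
          moreover have "(1 - t) * (1/2) = 1/2 - t/2"
            by (simp add: field_simps)
          ultimately show ?thesis
            using t \<alpha>(5) by (cases "t = 1") (simp, linarith)
        qed
        ultimately show "(\<lambda>w. (1 - t) * (?j \<circ> vertex_proj v) \<alpha> w + t * id \<alpha> w) \<in> U \<inter> V"
          by (simp add: U_def V_def proj_v e_def)
      next
        have "continuous_map (subtopology ?T (U \<inter> V)) ?T (vertex_proj v)"
          by (rule cont_proj) auto
        then show "continuous_map (subtopology ?T (U \<inter> V)) ?T (?j \<circ> vertex_proj v)"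
          using continuous_map_compose cont_j[of UNIV] by fastforce
      qed (auto simp: continuous_map_from_subtopology)
    qed
    have cont_v: "continuous_map ?T euclideanreal (\<lambda>\<alpha>. \<alpha> v)"
      by (rule continuous_map_product_projection) simp
    have "openin ?T {\<alpha> \<in> topspace ?T. \<alpha> v \<in> {..<1}}" "openin ?T {\<alpha> \<in> topspace ?T. \<alpha> v \<in> {0<..}}"
      by (rule openin_continuous_map_preimage[OF cont_v], simp)+
    moreover have "U = {\<alpha> \<in> topspace ?T. \<alpha> v \<in> {..<1}} \<inter> R" "V = {\<alpha> \<in> topspace ?T. \<alpha> v \<in> {0<..}} \<inter> R"
      by (auto simp: U_def V_def)
    ultimately have open_UV: "openin (subtopology ?T R) U" "openin (subtopology ?T R) V"
      unfolding openin_subtopology by blast+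
    have sub: "U \<subseteq> R" "V \<subseteq> R" "U \<inter> V \<subseteq> R"
      by (auto simp: U_def V_def)
    have "gacyclic k G (subtopology ?T R)"
    proof (rule gacyclic_Mayer_Vietoris[OF open_UV])
      show "topspace (subtopology ?T R) \<subseteq> U \<union> V"
        by (auto simp: U_def V_def)
      show "0 < k"
        using \<open>1 \<le> n\<close> insert.prems(4) by simp
    qed (use gU gV gUV sub in \<open>simp_all add: subtopology_subtopology Int_absorb1\<close>)
    then show ?thesis
      by (simp add: R_def)
  qed
qed

section \<open>Weak topology, compactness and finite subcomplexes\<close>

lemma closed_closed_simplex:
  assumes "finite \<sigma>"
  shows "closed (closed_simplex \<sigma>)"
  unfolding closed_simplex_def using assms
  by (intro closed_Collect_conj closed_Collect_all closed_Collect_imp closed_Collect_le closed_Collect_eq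
      continuous_intros continuous_on_product_coordinates) auto

lemma topspace_polyhedron: "topspace (polyhedron K) = realization K"
proof -
  have "openin (polyhedron K) (realization K)"
    unfolding openin_polyhedron realization_def
    by (auto simp: Int_absorb1 SUP_upper openin_subtopology_refl)
  then have "realization K \<subseteq> topspace (polyhedron K)"
    by (rule openin_subset)
  moreover have "topspace (polyhedron K) \<subseteq> realization K"
    using openin_topspace[of "polyhedron K"] unfolding openin_polyhedron realization_def by (rule conjunct1)
  ultimately show ?thesis
    by blast
qed

text \<open>An open set of the product meets each closed simplex in a relatively open set. Through
  this map singular simplices of the polyhedron are regarded as simplices in the product
  topology.\<close>

lemma continuous_map_polyhedron_powertop: "continuous_map (polyhedron K) (powertop_real UNIV) id"
proof -
  have "openin (polyhedron K) {x \<in> realization K. x \<in> U}" if "openin (powertop_real UNIV) U" for U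
    unfolding openin_polyhedron
  proof (intro conjI ballI)
    fix \<sigma> assume "\<sigma> \<in> K"
    then have "{x \<in> realization K. x \<in> U} \<inter> closed_simplex \<sigma> = U \<inter> closed_simplex \<sigma>"
      by (auto simp: realization_def)
    then show "openin (subtopology (powertop_real UNIV) (closed_simplex \<sigma>))
        ({x \<in> realization K. x \<in> U} \<inter> closed_simplex \<sigma>)"
      using that by (auto simp: openin_subtopology)
  qed (auto simp: realization_def)
  then show ?thesis
    by (simp add: continuous_map_def topspace_polyhedron)
qed

text \<open>The preimage of a closed set \<open>C\<close> is the union of its traces on the closed
  simplices of \<open>L\<close>. Each trace is closed in the product, and finiteness of
  \<open>L\<close> keeps the union closed.\<close>

lemma continuous_map_finite_subcomplex:
  assumes K: "abstract_complex K" and L: "finite L" "L \<subseteq> K"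
  shows "continuous_map (subtopology (powertop_real UNIV) (realization L)) (polyhedron K) id"
  unfolding continuous_map_closedin
proof (intro conjI allI impI)
  show "id \<in> topspace (subtopology (powertop_real UNIV) (realization L)) \<rightarrow> topspace (polyhedron K)"
    using L by (auto simp: topspace_polyhedron realization_def)
  fix C assume C: "closedin (polyhedron K) C"
  have "closed (C \<inter> closed_simplex \<sigma>)" if "\<sigma> \<in> L" for \<sigma>
  proof -
    have "openin (polyhedron K) (realization K - C)"
      using C by (simp add: closedin_def topspace_polyhedron)
    then have "openin (top_of_set (closed_simplex \<sigma>)) ((realization K - C) \<inter> closed_simplex \<sigma>)"
      using that L by (auto simp: openin_polyhedron euclidean_product_topology)
    moreover have "closed_simplex \<sigma> - (realization K - C) \<inter> closed_simplex \<sigma> = C \<inter> closed_simplex \<sigma>"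
      using that L by (auto simp: realization_def)
    ultimately have "closedin (top_of_set (closed_simplex \<sigma>)) (C \<inter> closed_simplex \<sigma>)"
      by (metis closedin_diff closedin_topspace topspace_euclidean_subtopology)
    moreover have "finite \<sigma>"
      using that K L by (auto simp: abstract_complex_def)
    ultimately show ?thesis
      using closed_closed_simplex closedin_closed_trans by blast
  qed
  then have "closed (\<Union>\<sigma>\<in>L. C \<inter> closed_simplex \<sigma>)"
    using L(1) by blast
  moreover have "{x \<in> topspace (subtopology (powertop_real UNIV) (realization L)). id x \<in> C} =
      (\<Union>\<sigma>\<in>L. C \<inter> closed_simplex \<sigma>)"
    by (auto simp: realization_def)
  ultimately show "closedin (subtopology (powertop_real UNIV) (realization L))
      {x \<in> topspace (subtopology (powertop_real UNIV) (realization L)). id x \<in> C}"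
    by (auto simp: euclidean_product_topology realization_def intro: closed_subset)
qed

text \<open>One point of \<open>S\<close> is chosen for each support that occurs. These points form
  a closed discrete subset of the polyhedron, which a compact set can contain only if it is
  finite.\<close>

lemma compactin_polyhedron_finite_supports:
  assumes K: "abstract_complex K" and S: "compactin (polyhedron K) S"
  shows "finite ((\<lambda>\<alpha>. {v. \<alpha> v \<noteq> 0}) ` S)"
proof -
  let ?s = "\<lambda>\<alpha> :: 'a \<Rightarrow> real. {v. \<alpha> v \<noteq> 0}"
  obtain D where D: "D \<subseteq> S" "inj_on ?s D" "?s ` S = ?s ` D"
    using subset_image_inj[of "?s ` S" ?s S] by auto
  have SK: "S \<subseteq> realization K"
    using compactin_subset_topspace[OF S] by (simp add: topspace_polyhedron)
  \<comment> \<open>Points of \<open>D'\<close> in a closed simplex have distinct supports inside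
    the finite set \<open>\<sigma>\<close>, so there are finitely many of them; hence every subset
    of \<open>D\<close> is closed.\<close>
  have "openin (polyhedron K) (realization K - D')" if D': "D' \<subseteq> D" for D'
    unfolding openin_polyhedron
  proof (intro conjI ballI)
    fix \<sigma> assume \<sigma>: "\<sigma> \<in> K"
    then have fin: "finite \<sigma>"
      using K by (simp add: abstract_complex_def)
    have "?s ` (D' \<inter> closed_simplex \<sigma>) \<subseteq> Pow \<sigma>"
      by (auto simp: closed_simplex_support[OF fin])
    then have "finite (?s ` (D' \<inter> closed_simplex \<sigma>))"
      using fin finite_subset by blast
    then have "finite (D' \<inter> closed_simplex \<sigma>)"
      by (rule finite_imageD) (use D' in \<open>auto intro: inj_on_subset[OF D(2)]\<close>)
    then have "closedin (powertop_real UNIV) (D' \<inter> closed_simplex \<sigma>)"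
      by (intro closedin_Hausdorff_finite) (simp_all add: Hausdorff_space_product_topology)
    then have "openin (powertop_real UNIV) (- (D' \<inter> closed_simplex \<sigma>))"
      by (simp add: closedin_def Compl_eq_Diff_UNIV)
    moreover have "(realization K - D') \<inter> closed_simplex \<sigma> = - (D' \<inter> closed_simplex \<sigma>) \<inter> closed_simplex \<sigma>"
      using \<sigma> by (auto simp: realization_def)
    ultimately show "openin (subtopology (powertop_real UNIV) (closed_simplex \<sigma>))
        ((realization K - D') \<inter> closed_simplex \<sigma>)"
      by (metis openin_subtopology)
  qed (auto simp: realization_def)
  then have open_D: "openin (polyhedron K) (realization K - (D - {d}))" for d
    by blast
  show ?thesis
  proof (cases "D = {}")
    case False
    \<comment> \<open>The open set belonging to \<open>d\<close> contains \<open>d\<close> and no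
      other point of \<open>D\<close>, so a finite subcover leaves only finitely many
      points.\<close>
    define \<U> where "\<U> = (\<lambda>d. realization K - (D - {d})) ` D"
    have "S \<subseteq> \<Union>\<U>"
      using SK False by (auto simp: \<U>_def)
    then obtain \<F> where \<F>: "finite \<F>" "\<F> \<subseteq> \<U>" "S \<subseteq> \<Union>\<F>"
      using S open_D unfolding compactin_def \<U>_def by (metis (no_types, lifting) imageE)
    then obtain E where E: "finite E" "\<F> = (\<lambda>d. realization K - (D - {d})) ` E"
      unfolding \<U>_def by (metis finite_subset_image)
    then have "D \<subseteq> E"
      using \<F>(3) D(1) by blast
    then show ?thesis
      using E(1) D(3) finite_subset by (metis finite_imageI)
  qed (use D in simp)
qed

text \<open>The cycle enters the finite subcomplex because the weak topology is finer than the
  product topology; the filling found there returns because the inclusion of a finite subcomplex is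
  continuous into the weak topology.\<close>

lemma gacyclic_polyhedron:
  fixes K :: "'v set set" and G :: "'g::ab_group_add itself"
  assumes K: "abstract_complex K" "complex_dim_le K n" and "n < k"
  shows "gacyclic k G (polyhedron K)"
  unfolding gacyclic_def
proof (intro allI impI)
  fix c :: "('v \<Rightarrow> real, 'g) gchain"
  assume c: "c \<in> gchains k (polyhedron K)" "gchain_boundary k c = 0"
  define S where "S = (\<Union>s\<in>Poly_Mapping.keys c. s ` standard_simplex k)"
  define F where "F = (\<lambda>\<alpha>. {v. \<alpha> v \<noteq> 0}) ` S"
  \<comment> \<open>The supports alone are not closed under faces; adding their nonempty faces gives
    the smallest subcomplex carrying \<open>S\<close>.\<close>
  define L where "L = {\<tau>. \<tau> \<noteq> {} \<and> (\<exists>\<sigma>\<in>F. \<tau> \<subseteq> \<sigma>)}"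
  have simplex: "singular_simplex k (polyhedron K) s" if "s \<in> Poly_Mapping.keys c" for s
    using c(1) that by (auto simp: gchains_def)
  have "compactin (polyhedron K) (s ` standard_simplex k)" if "s \<in> Poly_Mapping.keys c" for s
    using simplex[OF that] image_compactin[of "simplex_space k" "standard_simplex k" "polyhedron K" s]
    by (simp add: singular_simplex_def compactin_subtopology compactin_standard_simplex)
  then have comp: "compactin (polyhedron K) S"
    unfolding S_def by (intro compactin_Union) auto
  then have "finite F"
    unfolding F_def by (rule compactin_polyhedron_finite_supports[OF K(1)])
  have SK: "S \<subseteq> realization K"
    using compactin_subset_topspace[OF comp] by (simp add: topspace_polyhedron)
  have FK: "F \<subseteq> K"
    using support_in_complex(1)[OF K(1)] SK by (auto simp: F_def)
  then have finF: "finite \<sigma>" if "\<sigma> \<in> F" for \<sigma>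
    using that K(1) by (auto simp: abstract_complex_def)
  have LK: "L \<subseteq> K"
    using FK K(1) unfolding L_def abstract_complex_def by blast
  have "L \<subseteq> (\<Union>\<sigma>\<in>F. Pow \<sigma>)"
    by (auto simp: L_def)
  then have finL: "finite L"
    using \<open>finite F\<close> finF by (auto elim: finite_subset)
  have "\<rho> \<in> L" if "\<tau> \<in> L" "\<rho> \<subseteq> \<tau>" "\<rho> \<noteq> {}" for \<rho> \<tau>
    using that unfolding L_def by blast
  moreover have "finite \<tau> \<and> \<tau> \<noteq> {}" if "\<tau> \<in> L" for \<tau>
    using that LK K(1) unfolding abstract_complex_def by blast
  ultimately have L: "abstract_complex L"
    unfolding abstract_complex_def by blast
  have SL: "S \<subseteq> realization L"
  proof
    fix \<alpha> assume \<alpha>: "\<alpha> \<in> S"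
    then have "{v. \<alpha> v \<noteq> 0} \<in> F"
      by (auto simp: F_def)
    then have "{v. \<alpha> v \<noteq> 0} \<in> L"
      using FK K(1) unfolding L_def abstract_complex_def by blast
    moreover have "\<alpha> \<in> closed_simplex {v. \<alpha> v \<noteq> 0}"
      using SK \<alpha> by (intro support_in_complex(2)[OF K(1)]) blast
    ultimately show "\<alpha> \<in> realization L"
      unfolding realization_def by blast
  qed
  let ?X = "subtopology (powertop_real UNIV) (realization L)"
  have "gacyclic k G ?X"
  \<comment> \<open>Dimension at most \<open>n\<close> means at most \<open>Suc n\<close> vertices,
    and \<open>n < k\<close> is the required \<open>Suc n \<le> k\<close>.\<close>
  proof (rule gacyclic_finite_complex[of "\<Union>L"])
    show "finite (\<Union>L)"
      using finL LK K(1) by (auto simp: abstract_complex_def)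
    show "card \<sigma> \<le> Suc n" if "\<sigma> \<in> L" for \<sigma>
      using that LK K(2) by (auto simp: complex_dim_le_def)
  qed (use L \<open>n < k\<close> in auto)
  moreover have "c \<in> gchains k ?X"
    unfolding gchains_subtopology
  proof
    have "gchain_map k id c \<in> gchains k (powertop_real UNIV)"
      by (rule gchain_map_in_gchains[OF c(1) continuous_map_polyhedron_powertop])
    then show "c \<in> gchains k (powertop_real UNIV)"
      using gchain_map_ident[OF c(1), of id] by simp
    show "\<forall>s\<in>Poly_Mapping.keys c. s ` standard_simplex k \<subseteq> realization L"
      using SL unfolding S_def by blast
  qed
  ultimately have "gchain_map k id c \<in> gboundaries k G (polyhedron K)"
    using c(2) gchain_map_gboundaries[OF continuous_map_finite_subcomplex[OF K(1) finL LK]]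
    unfolding gacyclic_def by blast
  then show "c \<in> gboundaries k G (polyhedron K)"
    using gchain_map_ident[OF c(1), of id] by simp
qed


section \<open>Functoriality\<close>

definition gcycles :: "nat \<Rightarrow> 'a topology \<Rightarrow> ('a, 'g::ab_group_add) gchain set"
  where "gcycles k X = {c \<in> gchains k X. gchain_boundary k c = 0}"

definition gclass ::
    "nat \<Rightarrow> 'g::ab_group_add itself \<Rightarrow> 'a topology \<Rightarrow> ('a, 'g) gchain \<Rightarrow> ('a, 'g) gchain set"
  where "gclass k G X c = gboundaries k G X #>\<^bsub>gcycle_group k G X\<^esub> c"

lemma gclass_eq: "gclass k G X c = (\<lambda>b. b + c) ` gboundaries k G X"
  by (auto simp: gclass_def r_coset_def gcycle_group_def)

lemma gclass_self: "c \<in> gclass k G X c"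
  unfolding gclass_eq by (rule image_eqI[of _ _ 0]) simp_all

lemma gclass_eqI:
  assumes "c - d \<in> gboundaries k G X"
  shows "gclass k G X c = gclass k G X d"
proof -
  have "gclass k G X c \<subseteq> gclass k G X d" if "c - d \<in> gboundaries k G X" for c d :: "('a, 'b) gchain"
    unfolding gclass_eq
  proof (rule image_subsetI)
    fix b assume "b \<in> gboundaries k G X"
    then have "b + (c - d) \<in> gboundaries k G X"
      using that by (rule gboundaries_add)
    then show "b + c \<in> (\<lambda>b. b + d) ` gboundaries k G X"
      by (rule image_eqI[rotated]) simp
  qed
  then show ?thesis
    using assms gboundaries_minus[OF assms] by (intro subset_antisym) simp_all
qed

lemma carrier_ghomology: "carrier (ghomology k G X) = gclass k G X ` gcycles k X"
  by (auto simp: ghomology_def FactGroup_def RCOSETS_def gclass_def gcycles_def gcycle_group_def)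

lemma one_ghomology: "\<one>\<^bsub>ghomology k G X\<^esub> = gclass k G X 0"
  by (simp add: ghomology_def FactGroup_def gclass_eq)

text \<open>The quotient multiplies cosets as sets of sums: two boundaries combine into one, and
  conversely a boundary is split as itself plus 0.\<close>

lemma mult_ghomology:
  "gclass k G X c \<otimes>\<^bsub>ghomology k G X\<^esub> gclass k G X d = gclass k G X (c + d)"
proof -
  have "gclass k G X c \<otimes>\<^bsub>ghomology k G X\<^esub> gclass k G X d =
      (\<Union>a\<in>gboundaries k G X. \<Union>b\<in>gboundaries k G X. {(a + c) + (b + d)})"
    by (simp add: ghomology_def FactGroup_def set_mult_def gclass_eq gcycle_group_def)
  also have "\<dots> = (\<lambda>b. b + (c + d)) ` gboundaries k G X" (is "?L = ?R")
  proof
    show "?L \<subseteq> ?R"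
    proof clarify
      fix a b assume "a \<in> gboundaries k G X" "b \<in> gboundaries k G X"
      then have "a + b \<in> gboundaries k G X"
        by (rule gboundaries_add)
      then show "(a + c) + (b + d) \<in> ?R"
        by (rule image_eqI[rotated]) (simp add: algebra_simps)
    qed
    show "?R \<subseteq> ?L"
    proof (rule image_subsetI)
      fix b assume "b \<in> gboundaries k G X"
      then show "b + (c + d) \<in> ?L"
        by (intro UN_I[of b] UN_I[of 0]) (simp_all add: algebra_simps)
    qed
  qed
  finally show ?thesis
    by (simp add: gclass_eq)
qed

lemma gcycles_add: "c \<in> gcycles k X \<Longrightarrow> d \<in> gcycles k X \<Longrightarrow> c + d \<in> gcycles k X"
  by (simp add: gcycles_def gchains_add gchain_boundary_add)

lemma gcycles_0: "0 \<in> gcycles k X"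
  by (simp add: gcycles_def)

lemma gchain_map_gcycles:
  "c \<in> gcycles k X \<Longrightarrow> continuous_map X Y f \<Longrightarrow> gchain_map k f c \<in> gcycles k Y"
  by (auto simp: gcycles_def gchain_map_in_gchains gchain_boundary_map)

section \<open>Homotopy classes acting on homology\<close>

lemma hmaps_iff: "a \<in> hmaps X Y \<longleftrightarrow> (\<exists>f. continuous_map X Y f \<and> a = hclass X Y f)"
  by (auto simp: hmaps_def quotient_def hclass_def)

lemma hcomp_in_hmaps: "b \<in> hmaps Y Z \<Longrightarrow> a \<in> hmaps X Y \<Longrightarrow> hcomp X Z b a \<in> hmaps X Z"
  unfolding hmaps_iff by (metis hcomp_hclass continuous_map_compose)

lemma hcomp_assoc:
  assumes "a \<in> hmaps W X" "b \<in> hmaps X Y" "c \<in> hmaps Y Z"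
  shows "hcomp W Z c (hcomp W Y b a) = hcomp W Z (hcomp X Z c b) a"
proof -
  obtain f g h where "continuous_map W X f" "a = hclass W X f" "continuous_map X Y g" "b = hclass X Y g"
    "continuous_map Y Z h" "c = hclass Y Z h"
    using assms unfolding hmaps_iff by blast
  then show ?thesis
    by (simp add: hcomp_hclass continuous_map_compose o_assoc)
qed

text \<open>All cosets in the defining union coincide: another chain in the class changes the image
  by the image of a boundary, and another map in the homotopy class changes it by a boundary from
  \<open>gchain_homotopy\<close>.\<close>

lemma ghomology_map_gclass:
  assumes f: "continuous_map X Y f" and c: "c \<in> gcycles k X"
  shows "ghomology_map k G Y (hclass X Y f) (gclass k G X c) = gclass k G Y (gchain_map k f c)"
proof -
  have "gclass k G Y (gchain_map k f' c') = gclass k G Y (gchain_map k f c)"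
    if f'_in: "f' \<in> hclass X Y f" and c'_in: "c' \<in> gclass k G X c" for f' c'
  proof (rule gclass_eqI)
    have hom: "homotopic_with (\<lambda>_. True) X Y f f'"
      using f'_in by (simp add: hclass_def homotopy_rel_def)
    then have f': "continuous_map X Y f'"
      by (rule homotopic_with_imp_continuous_maps[THEN conjunct2])
    obtain b where b: "b \<in> gboundaries k G X" "c' = b + c"
      using c'_in by (auto simp: gclass_eq)
    have "gchain_map k f' c - gchain_map k f c \<in> gboundaries k G Y"
      by (rule gchain_homotopy[OF hom]) (use c in \<open>simp_all add: gcycles_def\<close>)
    then have "gchain_map k f' b + (gchain_map k f' c - gchain_map k f c) \<in> gboundaries k G Y"
      by (rule gboundaries_add[OF gchain_map_gboundaries[OF f' b(1)]])
    then show "gchain_map k f' c' - gchain_map k f c \<in> gboundaries k G Y"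
      by (simp add: b(2) gchain_map_add algebra_simps)
  qed
  moreover have "f \<in> hclass X Y f"
    using f by (simp add: hclass_def homotopy_rel_def)
  ultimately show ?thesis
    unfolding ghomology_map_def gclass_def[symmetric] using gclass_self[of c k G X] by blast
qed

lemma ghomology_map_closed:
  assumes "a \<in> hmaps X Y" "x \<in> carrier (ghomology k G X)"
  shows "ghomology_map k G Y a x \<in> carrier (ghomology k G Y)"
  using assms by (auto simp: hmaps_iff carrier_ghomology ghomology_map_gclass gchain_map_gcycles)

lemma ghomology_map_one:
  assumes "a \<in> hmaps X Y"
  shows "ghomology_map k G Y a \<one>\<^bsub>ghomology k G X\<^esub> = \<one>\<^bsub>ghomology k G Y\<^esub>"
  using assms by (auto simp: hmaps_iff one_ghomology ghomology_map_gclass gcycles_0)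

lemma ghomology_map_mult:
  assumes "a \<in> hmaps X Y" "x \<in> carrier (ghomology k G X)" "y \<in> carrier (ghomology k G X)"
  shows "ghomology_map k G Y a (x \<otimes>\<^bsub>ghomology k G X\<^esub> y) =
    ghomology_map k G Y a x \<otimes>\<^bsub>ghomology k G Y\<^esub> ghomology_map k G Y a y"
  using assms
  by (auto simp: hmaps_iff carrier_ghomology mult_ghomology ghomology_map_gclass gcycles_add gchain_map_add)

lemma ghomology_map_hid:
  assumes "x \<in> carrier (ghomology k G X)"
  shows "ghomology_map k G X (hid X) x = x"
proof -
  obtain c where "c \<in> gcycles k X" "x = gclass k G X c"
    using assms by (auto simp: carrier_ghomology)
  then show ?thesis
    by (simp add: hid_def ghomology_map_gclass gchain_map_ident[of c k X] gcycles_def)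
qed

lemma ghomology_map_hcomp:
  assumes "b \<in> hmaps Y Z" "a \<in> hmaps X Y" "x \<in> carrier (ghomology k G X)"
  shows "ghomology_map k G Z (hcomp X Z b a) x = ghomology_map k G Z b (ghomology_map k G Y a x)"
proof -
  obtain f g c where "continuous_map X Y f" "a = hclass X Y f" "continuous_map Y Z g" "b = hclass Y Z g"
    "c \<in> gcycles k X" "x = gclass k G X c"
    using assms unfolding hmaps_iff carrier_ghomology by blast
  then show ?thesis
    by (simp add: hcomp_hclass ghomology_map_gclass gchain_map_gcycles continuous_map_compose
        gchain_map_compose)
qed

lemma mult_ghomology_closed:
  "x \<in> carrier (ghomology k G X) \<Longrightarrow> y \<in> carrier (ghomology k G X) \<Longrightarrow>
    x \<otimes>\<^bsub>ghomology k G X\<^esub> y \<in> carrier (ghomology k G X)"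
  by (auto simp: carrier_ghomology mult_ghomology gcycles_add)

lemma one_ghomology_closed: "\<one>\<^bsub>ghomology k G X\<^esub> \<in> carrier (ghomology k G X)"
  by (simp add: carrier_ghomology one_ghomology gcycles_0)

lemma ghomology_one_mult_one:
  "\<one>\<^bsub>ghomology k G X\<^esub> \<otimes>\<^bsub>ghomology k G X\<^esub> \<one>\<^bsub>ghomology k G X\<^esub> = \<one>\<^bsub>ghomology k G X\<^esub>"
  by (simp add: one_ghomology mult_ghomology)

lemma gacyclic_trivial_ghomology:
  assumes "gacyclic k G X" "x \<in> carrier (ghomology k G X)"
  shows "x = \<one>\<^bsub>ghomology k G X\<^esub>"
proof -
  obtain c where "c \<in> gcycles k X" "x = gclass k G X c"
    using assms(2) by (auto simp: carrier_ghomology)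
  then show ?thesis
    using assms(1) gclass_eqI[of c 0 k G X] by (simp add: one_ghomology gacyclic_def gcycles_def)
qed


section \<open>Morphisms of inverse systems\<close>

lemma htop_systemD:
  assumes "htop_system S"
  shows "idx S \<noteq> {}" "i \<in> idx S \<Longrightarrow> ile S i i"
    "i \<in> idx S \<Longrightarrow> j \<in> idx S \<Longrightarrow> l \<in> idx S \<Longrightarrow> ile S i j \<Longrightarrow> ile S j l \<Longrightarrow> ile S i l"
    "i \<in> idx S \<Longrightarrow> j \<in> idx S \<Longrightarrow> \<exists>l\<in>idx S. ile S i l \<and> ile S j l"
    "i \<in> idx S \<Longrightarrow> j \<in> idx S \<Longrightarrow> ile S i j \<Longrightarrow> bond S i j \<in> hmaps (obj S j) (obj S i)"
    "i \<in> idx S \<Longrightarrow> bond S i i = hid (obj S i)"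
    "i \<in> idx S \<Longrightarrow> j \<in> idx S \<Longrightarrow> l \<in> idx S \<Longrightarrow> ile S i j \<Longrightarrow> ile S j l \<Longrightarrow>
      hcomp (obj S l) (obj S i) (bond S i j) (bond S j l) = bond S i l"
  using assms unfolding htop_system_def directed_def by blast+

lemma sys_morsD:
  assumes "h \<in> sys_mors S T" "\<mu> \<in> idx T"
  shows "snd h \<mu> \<in> idx S" "fst h \<mu> \<in> hmaps (obj S (snd h \<mu>)) (obj T \<mu>)"
  using assms by (auto simp: sys_mors_def)

lemma sys_mors_coherent:
  assumes "h \<in> sys_mors S T" "\<mu> \<in> idx T" "\<mu>' \<in> idx T" "ile T \<mu> \<mu>'"
  obtains l where "l \<in> idx S" "ile S (snd h \<mu>) l" "ile S (snd h \<mu>') l"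
    "along S T h \<mu> l = hcomp (obj S l) (obj T \<mu>) (bond T \<mu> \<mu>') (along S T h \<mu>' l)"
proof -
  have "\<exists>l\<in>idx S. ile S (snd h \<mu>) l \<and> ile S (snd h \<mu>') l \<and>
      along S T h \<mu> l = hcomp (obj S l) (obj T \<mu>) (bond T \<mu> \<mu>') (along S T h \<mu>' l)"
    using assms unfolding sys_mors_def mem_Collect_eq case_prod_unfold prod.collapse by blast
  then show thesis
    using that by blast
qed

lemma along_in_hmaps:
  assumes "htop_system S" "h \<in> sys_mors S T" "\<mu> \<in> idx T" "l \<in> idx S" "ile S (snd h \<mu>) l"
  shows "along S T h \<mu> l \<in> hmaps (obj S l) (obj T \<mu>)"
  unfolding along_def using sys_morsD[OF assms(2,3)] htop_systemD(5)[OF assms(1)] assms(4,5)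
  by (intro hcomp_in_hmaps) auto

text \<open>Identities that hold at one index persist at all larger ones, so witnesses of several
  coherence conditions can be moved to a common index.\<close>

lemma along_bond:
  assumes "htop_system S" "h \<in> sys_mors S T" "\<mu> \<in> idx T" "l \<in> idx S" "ile S (snd h \<mu>) l"
    "l' \<in> idx S" "ile S l l'"
  shows "hcomp (obj S l') (obj T \<mu>) (along S T h \<mu> l) (bond S l l') = along S T h \<mu> l'"
proof -
  note hm = sys_morsD[OF assms(2,3)]
  show ?thesis
    unfolding along_def htop_systemD(7)[OF assms(1) hm(1) assms(4,6,5,7), symmetric]
    by (rule hcomp_assoc[OF htop_systemD(5)[OF assms(1,4,6,7)] htop_systemD(5)[OF assms(1) hm(1) assms(4,5)]
          hm(2), symmetric])
qed

lemma sys_mor_rel_refl: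
  assumes "htop_system S" "h \<in> sys_mors S T"
  shows "(h, h) \<in> sys_mor_rel S T"
  using assms sys_morsD(1)[OF assms(2)] htop_systemD(2)[OF assms(1)]
  by (auto simp: sys_mor_rel_def)

text \<open>\<open>sys_mor_rel\<close> relates only genuine morphisms, so this is what makes the
  class of a composite inhabited. Coherence of \<open>g\<close> gives an index \<open>m\<close> of
  \<open>T\<close>; coherence of \<open>h\<close> towards \<open>m\<close>, used once for each of
  the two indices of \<open>U\<close>, gives indices of \<open>S\<close> with a common upper bound
  \<open>l\<close>, and both composites then factor through \<open>along S T h m l\<close>.\<close>

lemma sys_comp_in_sys_mors:
  assumes S: "htop_system S" and T: "htop_system T" and U: "htop_system U"
    and h: "h \<in> sys_mors S T" and g: "g \<in> sys_mors T U"
  shows "sys_comp S U g h \<in> sys_mors S U"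
proof -
  define \<phi> where "\<phi> = snd h \<circ> snd g"
  define f where "f \<nu> = hcomp (obj S (\<phi> \<nu>)) (obj U \<nu>) (fst g \<nu>) (fst h (snd g \<nu>))" for \<nu>
  have eq: "sys_comp S U g h = (f, \<phi>)"
    by (simp add: sys_comp_def f_def \<phi>_def case_prod_unfold fun_eq_iff)
  have \<phi>: "\<phi> \<nu> \<in> idx S" if "\<nu> \<in> idx U" for \<nu>
    using that sys_morsD(1)[OF g] sys_morsD(1)[OF h] by (simp add: \<phi>_def)
  have f: "f \<nu> \<in> hmaps (obj S (\<phi> \<nu>)) (obj U \<nu>)" if "\<nu> \<in> idx U" for \<nu>
    unfolding f_def \<phi>_def o_def
    using sys_morsD[OF g that] sys_morsD[OF h] by (intro hcomp_in_hmaps) auto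
  have along_f: "along S U (f, \<phi>) \<nu> l = hcomp (obj S l) (obj U \<nu>) (fst g \<nu>) (along S T h (snd g \<nu>) l)"
    if "\<nu> \<in> idx U" "l \<in> idx S" "ile S (\<phi> \<nu>) l" for \<nu> l
    unfolding along_def f_def \<phi>_def o_def fst_conv snd_conv
    using sys_morsD[OF g that(1)] sys_morsD[OF h] htop_systemD(5)[OF S] that(2,3) \<phi>[OF that(1)]
    by (intro hcomp_assoc[symmetric]) (auto simp: \<phi>_def)
  have shift: "hcomp (obj S l) (obj U \<nu>) (along T U g \<nu> m) (along S T h m l) = along S U (f, \<phi>) \<nu> l"
    if "\<nu> \<in> idx U" "m \<in> idx T" "ile T (snd g \<nu>) m" "l \<in> idx S" "ile S (\<phi> \<nu>) l" "ile S (snd h m) l"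
      "along S T h (snd g \<nu>) l = hcomp (obj S l) (obj T (snd g \<nu>)) (bond T (snd g \<nu>) m) (along S T h m l)"
    for \<nu> m l
    unfolding along_f[OF that(1,4,5)] that(7) along_def[of T U]
    using sys_morsD[OF g that(1)] htop_systemD(5)[OF T] along_in_hmaps[OF S h] that
    by (intro hcomp_assoc[symmetric]) auto
  have "\<exists>l\<in>idx S. ile S (\<phi> \<nu>) l \<and> ile S (\<phi> \<nu>') l \<and> along S U (f, \<phi>) \<nu> l =
      hcomp (obj S l) (obj U \<nu>) (bond U \<nu> \<nu>') (along S U (f, \<phi>) \<nu>' l)"
    if \<nu>: "\<nu> \<in> idx U" "\<nu>' \<in> idx U" "ile U \<nu> \<nu>'" for \<nu> \<nu>'
  proof -
    note gi = sys_morsD(1)[OF g \<nu>(1)] sys_morsD(1)[OF g \<nu>(2)]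
    obtain m where m: "m \<in> idx T" "ile T (snd g \<nu>) m" "ile T (snd g \<nu>') m"
      "along T U g \<nu> m = hcomp (obj T m) (obj U \<nu>) (bond U \<nu> \<nu>') (along T U g \<nu>' m)"
      using sys_mors_coherent[OF g \<nu>] by blast
    note hm = sys_morsD(1)[OF h m(1)]
    \<comment> \<open>Coherence of \<open>h\<close> between \<open>j\<close> and \<open>m\<close>,
      once valid at \<open>l\<close>, is carried to any larger \<open>l'\<close>.\<close>
    have raise: "along S T h j l' = hcomp (obj S l') (obj T j) (bond T j m) (along S T h m l')"
      if j: "j \<in> idx T" "ile T j m" and l: "l \<in> idx S" "ile S (snd h j) l" "ile S (snd h m) l"
        "along S T h j l = hcomp (obj S l) (obj T j) (bond T j m) (along S T h m l)"
        "l' \<in> idx S" "ile S l l'" for j l l'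
    proof -
      have "along S T h j l' = hcomp (obj S l') (obj T j)
          (hcomp (obj S l) (obj T j) (bond T j m) (along S T h m l)) (bond S l l')"
        using along_bond[OF S h j(1) l(1,2,5,6)] l(4) by simp
      also have "\<dots> = hcomp (obj S l') (obj T j) (bond T j m)
          (hcomp (obj S l') (obj T m) (along S T h m l) (bond S l l'))"
        using htop_systemD(5)[OF T] htop_systemD(5)[OF S] along_in_hmaps[OF S h m(1)] j l m(1)
        by (intro hcomp_assoc[symmetric]) auto
      finally show ?thesis
        using along_bond[OF S h m(1) l(1,3,5,6)] by simp
    qed
    obtain l1 where l1: "l1 \<in> idx S" "ile S (snd h (snd g \<nu>)) l1" "ile S (snd h m) l1"
      "along S T h (snd g \<nu>) l1 = hcomp (obj S l1) (obj T (snd g \<nu>)) (bond T (snd g \<nu>) m) (along S T h m l1)"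
      using sys_mors_coherent[OF h gi(1) m(1,2)] by blast
    obtain l2 where l2: "l2 \<in> idx S" "ile S (snd h (snd g \<nu>')) l2" "ile S (snd h m) l2"
      "along S T h (snd g \<nu>') l2 = hcomp (obj S l2) (obj T (snd g \<nu>')) (bond T (snd g \<nu>') m) (along S T h m l2)"
      using sys_mors_coherent[OF h gi(2) m(1,3)] by blast
    obtain l where l: "l \<in> idx S" "ile S l1 l" "ile S l2 l"
      using htop_systemD(4)[OF S l1(1) l2(1)] by blast
    have le: "ile S (\<phi> \<nu>) l" "ile S (\<phi> \<nu>') l" "ile S (snd h m) l"
      using htop_systemD(3)[OF S \<phi>[OF \<nu>(1)] l1(1) l(1)] l1(2) l(2)
        htop_systemD(3)[OF S \<phi>[OF \<nu>(2)] l2(1) l(1)] l2(2) l(3)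
        htop_systemD(3)[OF S hm l1(1) l(1) l1(3) l(2)]
      by (simp_all add: \<phi>_def)
    have "along S U (f, \<phi>) \<nu> l = hcomp (obj S l) (obj U \<nu>) (along T U g \<nu> m) (along S T h m l)"
      using shift[OF \<nu>(1) m(1,2) l(1) le(1,3)] raise[OF gi(1) m(2) l1 l(1,2)] by simp
    also have "\<dots> = hcomp (obj S l) (obj U \<nu>) (bond U \<nu> \<nu>')
        (hcomp (obj S l) (obj U \<nu>') (along T U g \<nu>' m) (along S T h m l))"
      unfolding m(4)
      using along_in_hmaps[OF S h m(1) l(1) le(3)] along_in_hmaps[OF T g \<nu>(2) m(1,3)]
        htop_systemD(5)[OF U \<nu>]
      by (intro hcomp_assoc[symmetric])
    also have "hcomp (obj S l) (obj U \<nu>') (along T U g \<nu>' m) (along S T h m l) = along S U (f, \<phi>) \<nu>' l"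
      using shift[OF \<nu>(2) m(1,3) l(1) le(2,3)] raise[OF gi(2) m(3) l2 l(1,3)] by simp
    finally show ?thesis
      using l(1) le by blast
  qed
  then show ?thesis
    unfolding eq using \<phi> f by (auto simp: sys_mors_def)
qed


section \<open>The induced homomorphism\<close>

lemma carrier_cech_homology:
  "x \<in> carrier (cech_homology k G S) \<longleftrightarrow> x \<in> (\<Pi>\<^sub>E i\<in>idx S. carrier (ghomology k G (obj S i))) \<and>
    (\<forall>i\<in>idx S. \<forall>j\<in>idx S. ile S i j \<longrightarrow> ghomology_map k G (obj S i) (bond S i j) (x j) = x i)"
  by (simp add: cech_homology_def inv_limit_def homology_sys_def)

lemma one_cech_homology: "\<one>\<^bsub>cech_homology k G S\<^esub> = (\<lambda>i\<in>idx S. \<one>\<^bsub>ghomology k G (obj S i)\<^esub>)"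
  by (simp add: cech_homology_def inv_limit_def homology_sys_def)

lemma mult_cech_homology:
  "x \<otimes>\<^bsub>cech_homology k G S\<^esub> y = (\<lambda>i\<in>idx S. x i \<otimes>\<^bsub>ghomology k G (obj S i)\<^esub> y i)"
  by (simp add: cech_homology_def inv_limit_def homology_sys_def)

lemma cech_homologyD:
  assumes "x \<in> carrier (cech_homology k G S)" "i \<in> idx S"
  shows "x i \<in> carrier (ghomology k G (obj S i))"
    "j \<in> idx S \<Longrightarrow> ile S i j \<Longrightarrow> ghomology_map k G (obj S i) (bond S i j) (x j) = x i"
  using assms by (auto simp: carrier_cech_homology)

lemma one_cech_homology_closed:
  assumes "htop_system S"
  shows "\<one>\<^bsub>cech_homology k G S\<^esub> \<in> carrier (cech_homology k G S)"
  unfolding carrier_cech_homology one_cech_homology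
  using htop_systemD(5)[OF assms]
  by (intro conjI ballI impI restrict_PiE_iff[THEN iffD2]) (simp_all add: one_ghomology_closed ghomology_map_one)

lemma mult_cech_homology_closed:
  assumes "htop_system S" "x \<in> carrier (cech_homology k G S)" "y \<in> carrier (cech_homology k G S)"
  shows "x \<otimes>\<^bsub>cech_homology k G S\<^esub> y \<in> carrier (cech_homology k G S)"
  unfolding carrier_cech_homology mult_cech_homology
proof (intro conjI ballI impI restrict_PiE_iff[THEN iffD2])
  show "x i \<otimes>\<^bsub>ghomology k G (obj S i)\<^esub> y i \<in> carrier (ghomology k G (obj S i))" if "i \<in> idx S" for i
    by (intro mult_ghomology_closed cech_homologyD(1) assms that)
  fix i j assume ij: "i \<in> idx S" "j \<in> idx S" "ile S i j"
  show "ghomology_map k G (obj S i) (bond S i j) ((\<lambda>i\<in>idx S. x i \<otimes>\<^bsub>ghomology k G (obj S i)\<^esub> y i) j) =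
      (\<lambda>i\<in>idx S. x i \<otimes>\<^bsub>ghomology k G (obj S i)\<^esub> y i) i"
    using ghomology_map_mult[OF htop_systemD(5)[OF assms(1) ij] cech_homologyD(1)[OF assms(2) ij(2)]
        cech_homologyD(1)[OF assms(3) ij(2)]]
      cech_homologyD(2)[OF assms(2) ij] cech_homologyD(2)[OF assms(3) ij] ij
    by simp
qed

lemma cech_map_apply:
  "\<mu> \<in> idx T \<Longrightarrow> cech_map k G T h x \<mu> = ghomology_map k G (obj T \<mu>) (fst h \<mu>) (x (snd h \<mu>))"
  by (simp add: cech_map_def inv_limit_map_def homology_sys_def case_prod_unfold)

lemma cech_map_extensional: "cech_map k G T h x \<in> extensional (idx T)"
  by (simp add: cech_map_def inv_limit_map_def homology_sys_def case_prod_unfold)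

lemma cech_map_eqI:
  assumes "y \<in> extensional (idx T)" "\<And>\<mu>. \<mu> \<in> idx T \<Longrightarrow> cech_map k G T h x \<mu> = y \<mu>"
  shows "cech_map k G T h x = y"
  using cech_map_extensional assms by (rule extensionalityI)

text \<open>Since \<open>x\<close> is compatible with the bonds, the component at
  \<open>\<mu>\<close> can be computed at any index above \<open>snd h \<mu>\<close>. This turns
  each condition of the form "for some larger index" into an equation of components.\<close>

lemma cech_map_along:
  assumes S: "htop_system S" and h: "h \<in> sys_mors S T" and \<mu>: "\<mu> \<in> idx T"
    and l: "l \<in> idx S" "ile S (snd h \<mu>) l" and x: "x \<in> carrier (cech_homology k G S)"
  shows "cech_map k G T h x \<mu> = ghomology_map k G (obj T \<mu>) (along S T h \<mu> l) (x l)"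
proof -
  note hm = sys_morsD[OF h \<mu>]
  have "ghomology_map k G (obj T \<mu>) (along S T h \<mu> l) (x l) =
      ghomology_map k G (obj T \<mu>) (fst h \<mu>)
        (ghomology_map k G (obj S (snd h \<mu>)) (bond S (snd h \<mu>) l) (x l))"
    unfolding along_def
    by (rule ghomology_map_hcomp[OF hm(2) htop_systemD(5)[OF S hm(1) l] cech_homologyD(1)[OF x l(1)]])
  then show ?thesis
    using cech_homologyD(2)[OF x hm(1) l] by (simp add: cech_map_apply[OF \<mu>])
qed

lemma cech_map_closed:
  assumes S: "htop_system S" and T: "htop_system T" and h: "h \<in> sys_mors S T"
    and x: "x \<in> carrier (cech_homology k G S)"
  shows "cech_map k G T h x \<in> carrier (cech_homology k G T)"
  unfolding carrier_cech_homology
proof (intro conjI ballI impI PiE_I)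
  show "cech_map k G T h x \<mu> \<in> carrier (ghomology k G (obj T \<mu>))" if "\<mu> \<in> idx T" for \<mu>
    using sys_morsD[OF h that] cech_homologyD(1)[OF x] that
    by (simp add: cech_map_apply ghomology_map_closed)
  show "cech_map k G T h x \<mu> = undefined" if "\<mu> \<notin> idx T" for \<mu>
    using that cech_map_extensional[of k G T h x] by (simp add: extensional_def)
  fix \<mu> \<mu>' assume \<mu>: "\<mu> \<in> idx T" "\<mu>' \<in> idx T" "ile T \<mu> \<mu>'"
  obtain l where l: "l \<in> idx S" "ile S (snd h \<mu>) l" "ile S (snd h \<mu>') l"
    "along S T h \<mu> l = hcomp (obj S l) (obj T \<mu>) (bond T \<mu> \<mu>') (along S T h \<mu>' l)"
    using sys_mors_coherent[OF h \<mu>] by blast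
  have "ghomology_map k G (obj T \<mu>) (along S T h \<mu> l) (x l) =
      ghomology_map k G (obj T \<mu>) (bond T \<mu> \<mu>') (ghomology_map k G (obj T \<mu>') (along S T h \<mu>' l) (x l))"
    unfolding l(4)
    by (rule ghomology_map_hcomp[OF htop_systemD(5)[OF T \<mu>] along_in_hmaps[OF S h \<mu>(2) l(1,3)]
          cech_homologyD(1)[OF x l(1)]])
  then show "ghomology_map k G (obj T \<mu>) (bond T \<mu> \<mu>') (cech_map k G T h x \<mu>') = cech_map k G T h x \<mu>"
    using cech_map_along[OF S h \<mu>(1) l(1,2) x] cech_map_along[OF S h \<mu>(2) l(1,3) x] by simp
qed

lemma cech_map_cong:
  assumes S: "htop_system S" and rel: "(h, h') \<in> sys_mor_rel S T" and x: "x \<in> carrier (cech_homology k G S)"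
  shows "cech_map k G T h x = cech_map k G T h' x"
proof (rule cech_map_eqI[OF cech_map_extensional])
  fix \<mu> assume \<mu>: "\<mu> \<in> idx T"
  have h: "h \<in> sys_mors S T" "h' \<in> sys_mors S T"
    using rel by (auto simp: sys_mor_rel_def)
  obtain l where "l \<in> idx S" "ile S (snd h \<mu>) l" "ile S (snd h' \<mu>) l"
    "along S T h \<mu> l = along S T h' \<mu> l"
    using rel \<mu> by (auto simp: sys_mor_rel_def)
  then show "cech_map k G T h x \<mu> = cech_map k G T h' x \<mu>"
    using cech_map_along[OF S h(1) \<mu> _ _ x] cech_map_along[OF S h(2) \<mu> _ _ x] by metis
qed

lemma cech_map_sys_comp:
  assumes h: "h \<in> sys_mors S T" and g: "g \<in> sys_mors T U" and x: "x \<in> carrier (cech_homology k G S)"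
  shows "cech_map k G U (sys_comp S U g h) x = cech_map k G U g (cech_map k G T h x)"
proof (rule cech_map_eqI[OF cech_map_extensional])
  fix \<nu> assume \<nu>: "\<nu> \<in> idx U"
  note gn = sys_morsD[OF g \<nu>]
  note hn = sys_morsD[OF h gn(1)]
  show "cech_map k G U (sys_comp S U g h) x \<nu> = cech_map k G U g (cech_map k G T h x) \<nu>"
    using ghomology_map_hcomp[OF gn(2) hn(2) cech_homologyD(1)[OF x hn(1)]]
    by (simp add: cech_map_apply \<nu> gn(1) sys_comp_def case_prod_unfold)
qed

lemma cech_map_id:
  assumes "x \<in> carrier (cech_homology k G S)"
  shows "cech_map k G S (\<lambda>i. hid (obj S i), id) x = x"
  using assms cech_homologyD(1)[OF assms]
  by (intro cech_map_eqI) (auto simp: carrier_cech_homology cech_map_apply ghomology_map_hid PiE_def)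

lemma cech_map_one:
  assumes "h \<in> sys_mors S T"
  shows "cech_map k G T h \<one>\<^bsub>cech_homology k G S\<^esub> = \<one>\<^bsub>cech_homology k G T\<^esub>"
  using sys_morsD[OF assms]
  by (intro cech_map_eqI) (simp_all add: one_cech_homology cech_map_apply ghomology_map_one)

text \<open>Elements of the limit are compared componentwise, so each \<open>\<mu>\<close> may use
  its own index and its own polyhedron; no compatibility between the factorizations is
  involved.\<close>

lemma cech_map_dim_le:
  assumes S: "htop_system S" and h: "h \<in> sys_mors S T" "sys_mor_dim_le S T h n" and "n < k"
    and x: "x \<in> carrier (cech_homology k G S)"
  shows "cech_map k G T h x = \<one>\<^bsub>cech_homology k G T\<^esub>"
proof (rule cech_map_eqI)
  show "\<one>\<^bsub>cech_homology k G T\<^esub> \<in> extensional (idx T)"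
    by (simp add: one_cech_homology)
  fix \<mu> assume \<mu>: "\<mu> \<in> idx T"
  then obtain l and K :: "'b set set" and u v where l: "l \<in> idx S" "ile S (snd h \<mu>) l"
    and K: "abstract_complex K" "complex_dim_le K n"
    and uv: "u \<in> hmaps (obj S l) (polyhedron K)" "v \<in> hmaps (polyhedron K) (obj T \<mu>)"
    and eq: "along S T h \<mu> l = hcomp (obj S l) (obj T \<mu>) v u"
    using h(2) unfolding sys_mor_dim_le_def by blast
  note xl = cech_homologyD(1)[OF x l(1)]
  have "ghomology_map k G (polyhedron K) u (x l) = \<one>\<^bsub>ghomology k G (polyhedron K)\<^esub>"
    by (rule gacyclic_trivial_ghomology[OF gacyclic_polyhedron[OF K \<open>n < k\<close>] ghomology_map_closed[OF uv(1) xl]])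
  then have "ghomology_map k G (obj T \<mu>) (along S T h \<mu> l) (x l) = \<one>\<^bsub>ghomology k G (obj T \<mu>)\<^esub>"
    unfolding eq using ghomology_map_hcomp[OF uv(2,1) xl] ghomology_map_one[OF uv(2)] by simp
  then show "cech_map k G T h x \<mu> = \<one>\<^bsub>cech_homology k G T\<^esub> \<mu>"
    using cech_map_along[OF S h(1) \<mu> l x] \<mu> by (simp add: one_cech_homology)
qed

section \<open>Pro-morphisms and change of representation\<close>

lemma pro_mors_sys_mors: "\<f> \<in> pro_mors S T \<Longrightarrow> h \<in> \<f> \<Longrightarrow> h \<in> sys_mors S T"
  by (auto simp: pro_mors_def quotient_def sys_mor_rel_def)

lemma pro_mors_nonempty:
  assumes "htop_system S" "\<f> \<in> pro_mors S T"
  shows "\<f> \<noteq> {}"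
proof -
  obtain h where "h \<in> sys_mors S T" "\<f> = sys_mor_rel S T `` {h}"
    using assms(2) by (auto simp: pro_mors_def elim: quotientE)
  then show ?thesis
    using sys_mor_rel_refl[OF assms(1)] by blast
qed

lemma pro_mors_cech_map:
  assumes S: "htop_system S" and \<f>: "\<f> \<in> pro_mors S T" "h \<in> \<f>" "h' \<in> \<f>"
    and x: "x \<in> carrier (cech_homology k G S)"
  shows "cech_map k G T h x = cech_map k G T h' x"
proof -
  obtain h0 where "(h0, h) \<in> sys_mor_rel S T" "(h0, h') \<in> sys_mor_rel S T"
    using \<f> by (auto simp: pro_mors_def quotient_def)
  then show ?thesis
    using cech_map_cong[OF S _ x] by metis
qed

text \<open>A member \<open>z\<close> of the composite class may stem from other representatives
  than \<open>f\<close> and \<open>g\<close>; on the limits these induce the same maps.\<close>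

lemma pro_comp_cech_map:
  assumes S: "htop_system S" and T: "htop_system T"
    and \<f>: "\<f> \<in> pro_mors S T" "f \<in> \<f>" and \<g>: "\<g> \<in> pro_mors T U" "g \<in> \<g>"
    and z: "z \<in> pro_comp S U \<g> \<f>" and x: "x \<in> carrier (cech_homology k G S)"
  shows "cech_map k G U z x = cech_map k G U g (cech_map k G T f x)"
proof -
  obtain g' f' where f': "f' \<in> \<f>" and g': "g' \<in> \<g>" and rel: "(sys_comp S U g' f', z) \<in> sys_mor_rel S U"
    using z by (auto simp: pro_comp_def pro_class_def)
  note f'm = pro_mors_sys_mors[OF \<f>(1) f'] and g'm = pro_mors_sys_mors[OF \<g>(1) g']
  have "cech_map k G U z x = cech_map k G U g' (cech_map k G T f' x)"
    using cech_map_cong[OF S rel x] cech_map_sys_comp[OF f'm g'm x] by simp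
  also have "\<dots> = cech_map k G U g (cech_map k G T f' x)"
    using assms(5-6) g' cech_map_closed[OF S T f'm x] by (intro pro_mors_cech_map[OF T])
  finally show ?thesis
    using pro_mors_cech_map[OF S \<f>(1) f' \<f>(2) x] by simp
qed

lemma pro_comp_nonempty:
  assumes "htop_system S" "htop_system T" "htop_system U"
    and "\<f> \<in> pro_mors S T" "\<g> \<in> pro_mors T U"
  obtains z where "z \<in> pro_comp S U \<g> \<f>"
proof -
  obtain f g where "f \<in> \<f>" "g \<in> \<g>"
    using pro_mors_nonempty[OF assms(1,4)] pro_mors_nonempty[OF assms(2,5)] by blast
  moreover from this have "sys_comp S U g f \<in> sys_mors S U"
    using assms by (intro sys_comp_in_sys_mors pro_mors_sys_mors)
  ultimately show thesis
    using that[of "sys_comp S U g f"] sys_mor_rel_refl[OF assms(1), of "sys_comp S U g f" U]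
    by (auto simp: pro_comp_def pro_class_def)
qed

text \<open>A single \<open>z\<close> in the common class computes both composites. That the class
  is inhabited matters: equality of two empty unions would carry no information.\<close>

lemma pro_comp_eq_cech_map:
  assumes sys: "htop_system S" "htop_system T" "htop_system T'" "htop_system U"
    and \<f>: "\<f> \<in> pro_mors S T" "f \<in> \<f>" and \<g>: "\<g> \<in> pro_mors T U" "g \<in> \<g>"
    and \<f>': "\<f>' \<in> pro_mors S T'" "f' \<in> \<f>'" and \<g>': "\<g>' \<in> pro_mors T' U" "g' \<in> \<g>'"
    and eq: "pro_comp S U \<g> \<f> = pro_comp S U \<g>' \<f>'" and x: "x \<in> carrier (cech_homology k G S)"
  shows "cech_map k G U g (cech_map k G T f x) = cech_map k G U g' (cech_map k G T' f' x)"
proof -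
  obtain z where "z \<in> pro_comp S U \<g> \<f>"
    using pro_comp_nonempty[OF sys(1,2,4) \<f>(1) \<g>(1)] by blast
  then show ?thesis
    using pro_comp_cech_map[OF sys(1,2) \<f> \<g> _ x] pro_comp_cech_map[OF sys(1,3) \<f>' \<g>' _ x] eq by metis
qed

lemma pro_comp_id_cech_map:
  assumes sys: "htop_system S" "htop_system T"
    and \<f>: "\<f> \<in> pro_mors S T" "f \<in> \<f>" and \<g>: "\<g> \<in> pro_mors T S" "g \<in> \<g>"
    and eq: "pro_comp S S \<g> \<f> = pro_id S" and x: "x \<in> carrier (cech_homology k G S)"
  shows "cech_map k G S g (cech_map k G T f x) = x"
proof -
  obtain z where z: "z \<in> pro_comp S S \<g> \<f>"
    using pro_comp_nonempty[OF sys(1,2,1) \<f>(1) \<g>(1)] by blast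
  then have "((\<lambda>i. hid (obj S i), id), z) \<in> sys_mor_rel S S"
    by (simp add: eq pro_id_def pro_class_def)
  then have "cech_map k G S z x = x"
    using cech_map_cong[OF sys(1) _ x] cech_map_id[OF x] by metis
  then show ?thesis
    using pro_comp_cech_map[OF sys \<f> \<g> z x] by simp
qed

text \<open>The square shows that the map of \<open>f\<close> becomes null after the map of
  \<open>b\<close>, and the latter is injective because \<open>b'\<close> induces a left
  inverse.\<close>

lemma cech_map_null_source:
  assumes sys: "htop_system S" "htop_system S'" "htop_system T" "htop_system T'"
    and \<f>: "\<f> \<in> pro_mors S T" "f \<in> \<f>" and \<f>': "\<f>' \<in> pro_mors S' T'" "f' \<in> \<f>'"
    and \<a>: "\<a> \<in> pro_isos S S'" and \<b>: "\<b> \<in> pro_isos T T'"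
    and eq: "pro_comp S T' \<b> \<f> = pro_comp S T' \<f>' \<a>"
    and null: "\<And>y. y \<in> carrier (cech_homology k G S') \<Longrightarrow> cech_map k G T' f' y = \<one>\<^bsub>cech_homology k G T'\<^esub>"
    and x: "x \<in> carrier (cech_homology k G S)"
  shows "cech_map k G T f x = \<one>\<^bsub>cech_homology k G T\<^esub>"
proof -
  obtain \<b>' where bp: "\<b> \<in> pro_mors T T'" "\<b>' \<in> pro_mors T' T" and id: "pro_comp T T \<b>' \<b> = pro_id T"
    using \<b> by (auto simp: pro_isos_def)
  have ap: "\<a> \<in> pro_mors S S'"
    using \<a> by (simp add: pro_isos_def)
  obtain a b b' where mem: "a \<in> \<a>" "b \<in> \<b>" "b' \<in> \<b>'"
    using pro_mors_nonempty[OF sys(1) ap] pro_mors_nonempty[OF sys(3) bp(1)]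
      pro_mors_nonempty[OF sys(4) bp(2)] by blast
  have "cech_map k G T' b (cech_map k G T f x) = cech_map k G T' f' (cech_map k G S' a x)"
    by (rule pro_comp_eq_cech_map[OF sys(1,3,2,4) \<f> bp(1) mem(2) ap mem(1) \<f>' eq x])
  also have "\<dots> = \<one>\<^bsub>cech_homology k G T'\<^esub>"
    by (rule null[OF cech_map_closed[OF sys(1,2) pro_mors_sys_mors[OF ap mem(1)] x]])
  finally have "cech_map k G T b' (cech_map k G T' b (cech_map k G T f x)) = \<one>\<^bsub>cech_homology k G T\<^esub>"
    using cech_map_one[OF pro_mors_sys_mors[OF bp(2) mem(3)]] by simp
  then show ?thesis
    using pro_comp_id_cech_map[OF sys(3,4) bp(1) mem(2) bp(2) mem(3) id
        cech_map_closed[OF sys(1,3) pro_mors_sys_mors[OF \<f>] x]] by simp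
qed

text \<open>Every \<open>x\<close> is the image under \<open>a\<close> of some \<open>?y\<close>, as
  \<open>a'\<close> induces a right inverse; by the square the map of \<open>f'\<close> at
  \<open>x\<close> is the map of \<open>b\<close> applied to a null element.\<close>

lemma cech_map_null_target:
  assumes sys: "htop_system S" "htop_system S'" "htop_system T" "htop_system T'"
    and \<f>: "\<f> \<in> pro_mors S T" "f \<in> \<f>" and \<f>': "\<f>' \<in> pro_mors S' T'" "f' \<in> \<f>'"
    and \<a>: "\<a> \<in> pro_isos S S'" and \<b>: "\<b> \<in> pro_isos T T'"
    and eq: "pro_comp S T' \<b> \<f> = pro_comp S T' \<f>' \<a>"
    and null: "\<And>y. y \<in> carrier (cech_homology k G S) \<Longrightarrow> cech_map k G T f y = \<one>\<^bsub>cech_homology k G T\<^esub>"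
    and x: "x \<in> carrier (cech_homology k G S')"
  shows "cech_map k G T' f' x = \<one>\<^bsub>cech_homology k G T'\<^esub>"
proof -
  obtain \<a>' where ap: "\<a> \<in> pro_mors S S'" "\<a>' \<in> pro_mors S' S" and id: "pro_comp S' S' \<a> \<a>' = pro_id S'"
    using \<a> by (auto simp: pro_isos_def)
  have bp: "\<b> \<in> pro_mors T T'"
    using \<b> by (simp add: pro_isos_def)
  obtain a b a' where mem: "a \<in> \<a>" "b \<in> \<b>" "a' \<in> \<a>'"
    using pro_mors_nonempty[OF sys(1) ap(1)] pro_mors_nonempty[OF sys(2) ap(2)]
      pro_mors_nonempty[OF sys(3) bp] by blast
  let ?y = "cech_map k G S a' x"
  have y: "?y \<in> carrier (cech_homology k G S)"
    by (rule cech_map_closed[OF sys(2,1) pro_mors_sys_mors[OF ap(2) mem(3)] x])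
  have "cech_map k G T' f' x = cech_map k G T' f' (cech_map k G S' a ?y)"
    using pro_comp_id_cech_map[OF sys(2,1) ap(2) mem(3) ap(1) mem(1) id x] by simp
  also have "\<dots> = cech_map k G T' b (cech_map k G T f ?y)"
    by (rule pro_comp_eq_cech_map[OF sys(1,3,2,4) \<f> bp mem(2) ap(1) mem(1) \<f>' eq y, symmetric])
  also have "\<dots> = \<one>\<^bsub>cech_homology k G T'\<^esub>"
    using null[OF y] cech_map_one[OF pro_mors_sys_mors[OF bp mem(2)]] by simp
  finally show ?thesis .
qed

lemma shape_reps_htop_system:
  assumes "(S, p, T, q, \<f>) \<in> shape_reps X Y"
  shows "htop_system S" "htop_system T" "\<f> \<in> pro_mors S T"
  using assms by (auto simp: shape_reps_def hpol_expansion_def hpol_system_def)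

theorem corollary5:
  fixes X Y :: "'a topology"
    and F :: "('i, 'j, 'a) shape_rep set"
    and G :: "'g::ab_group_add itself"
    and n k :: nat
  assumes "F \<in> shape_mors X Y"
    and "sd_le F n"
    and "k > n"
  shows "\<forall>(S, p, T, q, \<f>)\<in>F. \<forall>h\<in>\<f>.
    trivial_homomorphism (cech_homology k G S) (cech_homology k G T) (cech_map k G T h)"
proof clarify
  fix S p T q \<f> h assume F: "(S, p, T, q, \<f>) \<in> F" and h: "h \<in> \<f>"
  \<comment> \<open>\<open>F\<close> is the class of this representation, so the isomorphisms lead
    from it to the given one and to the one of small dimension. Nullity hence travels first against
    the arrows, from index 0 to index 1, and then along them.\<close>
  obtain S1 p1 T1 q1 \<f>1 where "F = shape_rel X Y `` {(S1, p1, T1, q1, \<f>1)}"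
    using assms(1) unfolding shape_mors_def quotient_def by auto
  moreover obtain S0 p0 T0 q0 \<f>0 where F0: "(S0, p0, T0, q0, \<f>0) \<in> F" "pro_dim_le S0 T0 \<f>0 n"
    using assms(2) unfolding sd_le_def by auto
  ultimately have rel: "((S1, p1, T1, q1, \<f>1), (S, p, T, q, \<f>)) \<in> shape_rel X Y"
    and rel0: "((S1, p1, T1, q1, \<f>1), (S0, p0, T0, q0, \<f>0)) \<in> shape_rel X Y"
    using F by auto
  obtain \<a> \<b> where ab: "\<a> \<in> pro_isos S1 S" "\<b> \<in> pro_isos T1 T" "pro_comp S1 T \<b> \<f>1 = pro_comp S1 T \<f> \<a>"
    using rel unfolding shape_rel_def by auto
  obtain \<a>0 \<b>0 where ab0: "\<a>0 \<in> pro_isos S1 S0" "\<b>0 \<in> pro_isos T1 T0"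
    "pro_comp S1 T0 \<b>0 \<f>1 = pro_comp S1 T0 \<f>0 \<a>0"
    using rel0 unfolding shape_rel_def by auto
  have "(S, p, T, q, \<f>) \<in> shape_reps X Y" "(S0, p0, T0, q0, \<f>0) \<in> shape_reps X Y"
    "(S1, p1, T1, q1, \<f>1) \<in> shape_reps X Y"
    using rel rel0 unfolding shape_rel_def by auto
  note r = this[THEN shape_reps_htop_system(1)] this[THEN shape_reps_htop_system(2)]
    this[THEN shape_reps_htop_system(3)]
  obtain h0 where h0: "h0 \<in> \<f>0" "sys_mor_dim_le S0 T0 h0 n"
    using F0(2) by (auto simp: pro_dim_le_def)
  obtain h1 where h1: "h1 \<in> \<f>1"
    using pro_mors_nonempty[OF r(3,9)] by blast
  have "cech_map k G T0 h0 x = \<one>\<^bsub>cech_homology k G T0\<^esub>" if "x \<in> carrier (cech_homology k G S0)" for x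
    using cech_map_dim_le[OF r(2) pro_mors_sys_mors[OF r(8) h0(1)] h0(2) assms(3) that] .
  then have "cech_map k G T1 h1 x = \<one>\<^bsub>cech_homology k G T1\<^esub>" if "x \<in> carrier (cech_homology k G S1)" for x
    using that by (rule cech_map_null_source[OF r(3,2,6,5,9) h1 r(8) h0(1) ab0])
  then have null: "cech_map k G T h x = \<one>\<^bsub>cech_homology k G T\<^esub>" if "x \<in> carrier (cech_homology k G S)" for x
    using that by (rule cech_map_null_target[OF r(3,1,6,4,9) h1 r(7) h ab])
  have "\<one>\<^bsub>cech_homology k G T\<^esub> \<otimes>\<^bsub>cech_homology k G T\<^esub> \<one>\<^bsub>cech_homology k G T\<^esub> = \<one>\<^bsub>cech_homology k G T\<^esub>"
    by (simp add: mult_cech_homology one_cech_homology ghomology_one_mult_one cong: restrict_cong)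
  \<comment> \<open>A map with constant value one is multiplicative because one times one is one;
    closure of the source under multiplication makes the value at a product constant too.\<close>
  then have "cech_map k G T h \<in> hom (cech_homology k G S) (cech_homology k G T)"
    by (auto simp: hom_def null one_cech_homology_closed[OF r(4)] mult_cech_homology_closed[OF r(1)])
  then show "trivial_homomorphism (cech_homology k G S) (cech_homology k G T) (cech_map k G T h)"
    by (simp add: trivial_homomorphism_def null)
qed

end
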